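(* Let $R$ be a right $a$-ring. Then $R$ is a direct sum (as rings) $R = S\oplus T$, where $S$ is a semisimple artinian ring such that $S_S$ is square-full, and $T$ is a right square-free ring, i.e. $T_T$ is a square-free module. (Either summand may be zero.)
   Context: Rings are associative with identity; modules are right unital. A right module $M$ is automorphism-invariant if $\varphi(M)\subseteq M$ for every automorphism $\varphi$ of its injective envelope $E(M)$. A ring $R$ is a right $a$-ring if every right ideal of $R$ is automorphism-invariant as a right $R$-module. A submodule $N$ of a module $M$ is a square root in $M$ if $N\oplus N$ embeds in $M$. $M$ is square-free if it contains no nonzero square roots (equivalently, no nonzero submodule isomorphic to $X\oplus X$ for a module $X$). $M$ is square-full if every nonzero submodule of $M$ contains a nonzero square root in $M$. *)

theory Defs
  imports "HOL-Algebra.Chinese_Remainder"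
begin

section \<open>Right modules over a ring with identity\<close>

(* HOL-Algebra only has modules over commutative rings.  As with its record "module",
   the fields mult and one inherited from "ring" carry no meaning. *)

record ('a, 'b) rmodule = "'b ring" +
  rsmult :: "'b \<Rightarrow> 'a \<Rightarrow> 'b" (infixl "\<bullet>\<index>" 70)

locale rmodule = R?: ring R + M?: abelian_group M
  for R :: "('a, 'm) ring_scheme" (structure)
    and M :: "('a, 'b, 'n) rmodule_scheme" (structure) +
  assumes rsmult_closed:
      "\<lbrakk>x \<in> carrier M; r \<in> carrier R\<rbrakk> \<Longrightarrow> x \<bullet>\<^bsub>M\<^esub> r \<in> carrier M"
    and rsmult_add_left:
      "\<lbrakk>x \<in> carrier M; y \<in> carrier M; r \<in> carrier R\<rbrakk>
        \<Longrightarrow> (x \<oplus>\<^bsub>M\<^esub> y) \<bullet>\<^bsub>M\<^esub> r = x \<bullet>\<^bsub>M\<^esub> r \<oplus>\<^bsub>M\<^esub> y \<bullet>\<^bsub>M\<^esub> r"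
    and rsmult_add_right:
      "\<lbrakk>x \<in> carrier M; r \<in> carrier R; s \<in> carrier R\<rbrakk>
        \<Longrightarrow> x \<bullet>\<^bsub>M\<^esub> (r \<oplus>\<^bsub>R\<^esub> s) = x \<bullet>\<^bsub>M\<^esub> r \<oplus>\<^bsub>M\<^esub> x \<bullet>\<^bsub>M\<^esub> s"
    and rsmult_assoc:
      "\<lbrakk>x \<in> carrier M; r \<in> carrier R; s \<in> carrier R\<rbrakk>
        \<Longrightarrow> x \<bullet>\<^bsub>M\<^esub> (r \<otimes>\<^bsub>R\<^esub> s) = (x \<bullet>\<^bsub>M\<^esub> r) \<bullet>\<^bsub>M\<^esub> s"
    and rsmult_one:
      "x \<in> carrier M \<Longrightarrow> x \<bullet>\<^bsub>M\<^esub> \<one>\<^bsub>R\<^esub> = x"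

definition rsubmodule ::
    "'b set \<Rightarrow> ('a, 'm) ring_scheme \<Rightarrow> ('a, 'b, 'n) rmodule_scheme \<Rightarrow> bool" where
  "rsubmodule N R M \<longleftrightarrow>
     additive_subgroup N M \<and> (\<forall>x\<in>N. \<forall>r\<in>carrier R. x \<bullet>\<^bsub>M\<^esub> r \<in> N)"

abbreviation restrict_rmodule ::
    "('a, 'b, 'n) rmodule_scheme \<Rightarrow> 'b set \<Rightarrow> ('a, 'b, 'n) rmodule_scheme" where
  "restrict_rmodule M N \<equiv> M\<lparr>carrier := N\<rparr>"

definition rmodule_hom ::
    "('a, 'm) ring_scheme \<Rightarrow> ('a, 'b, 'n) rmodule_scheme \<Rightarrow> ('a, 'c, 'k) rmodule_scheme
      \<Rightarrow> ('b \<Rightarrow> 'c) set" where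
  "rmodule_hom R M N =
     {f. f \<in> carrier M \<rightarrow> carrier N \<and>
         (\<forall>x\<in>carrier M. \<forall>y\<in>carrier M. f (x \<oplus>\<^bsub>M\<^esub> y) = f x \<oplus>\<^bsub>N\<^esub> f y) \<and>
         (\<forall>x\<in>carrier M. \<forall>r\<in>carrier R. f (x \<bullet>\<^bsub>M\<^esub> r) = f x \<bullet>\<^bsub>N\<^esub> r)}"

definition rmodule_aut ::
    "('a, 'm) ring_scheme \<Rightarrow> ('a, 'b, 'n) rmodule_scheme \<Rightarrow> ('b \<Rightarrow> 'b) set" where
  "rmodule_aut R M = {f \<in> rmodule_hom R M M. bij_betw f (carrier M) (carrier M)}"

definition rmodule_embeds ::
    "('a, 'm) ring_scheme \<Rightarrow> ('a, 'b, 'n) rmodule_scheme \<Rightarrow> ('a, 'c, 'k) rmodule_scheme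
      \<Rightarrow> bool" where
  "rmodule_embeds R M N \<longleftrightarrow> (\<exists>f \<in> rmodule_hom R M N. inj_on f (carrier M))"

definition rmodule_sum ::
    "('a, 'b, 'n) rmodule_scheme \<Rightarrow> ('a, 'c, 'k) rmodule_scheme \<Rightarrow> ('a, 'b \<times> 'c) rmodule" where
  "rmodule_sum M N =
     \<lparr>carrier = carrier M \<times> carrier N,
      mult = undefined, one = undefined,
      zero = (\<zero>\<^bsub>M\<^esub>, \<zero>\<^bsub>N\<^esub>),
      add = (\<lambda>(x, y) (x', y'). (x \<oplus>\<^bsub>M\<^esub> x', y \<oplus>\<^bsub>N\<^esub> y')),
      rsmult = (\<lambda>(x, y) r. (x \<bullet>\<^bsub>M\<^esub> r, y \<bullet>\<^bsub>N\<^esub> r))\<rparr>"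

text \<open>The right regular module \<open>R\<^sub>R\<close>; its submodules are the right ideals of \<open>R\<close>.\<close>

definition right_regular :: "('a, 'm) ring_scheme \<Rightarrow> ('a, 'a) rmodule" where
  "right_regular R =
     \<lparr>carrier = carrier R, mult = mult R, one = one R, zero = zero R, add = add R,
      rsmult = mult R\<rparr>"

abbreviation right_ideal :: "'a set \<Rightarrow> ('a, 'm) ring_scheme \<Rightarrow> bool" where
  "right_ideal I R \<equiv> rsubmodule I R (right_regular R)"


section \<open>Injective envelopes\<close>

text \<open>
  HOL cannot quantify over all types inside a formula, so modules that are quantified over
  have to live in a fixed type, chosen large enough.  For a ring over the type \<open>'a\<close> and a
  module \<open>M\<close> over the type \<open>'b\<close> we use the following type.  It has room for an injective
  envelope of \<open>M\<close>: the divisible hull \<open>D\<close> of the abelian group \<open>M\<close> has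
  cardinality at most that of \<open>'b \<times> nat\<close>, \<open>M\<close> embeds in the injective right
  \<open>R\<close>-module \<open>Hom\<^sub>\<int>(R, D)\<close> by \<open>x \<mapsto> (r \<mapsto> x \<bullet> r)\<close>, and
  \<open>Hom\<^sub>\<int>(R, D)\<close> contains an injective envelope of \<open>M\<close>.
\<close>

type_synonym ('a, 'b) envelope_type = "'a \<Rightarrow> 'b \<times> nat"

text \<open>
  The test modules \<open>B\<close> range over a type that contains a copy of \<open>R\<^sub>R\<close>.  By Baer's
  criterion this is injectivity with respect to right \<open>R\<close>-modules of every size.
\<close>

definition injective_rmodule ::
    "('a, 'm) ring_scheme \<Rightarrow> ('a, 'c, 'n) rmodule_scheme \<Rightarrow> bool" where
  "injective_rmodule R E \<longleftrightarrow>
     rmodule R E \<and>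
     (\<forall>(B :: ('a, ('a, 'a) envelope_type) rmodule) A.
        rmodule R B \<and> rsubmodule A R B \<longrightarrow>
        (\<forall>f \<in> rmodule_hom R (restrict_rmodule B A) E.
           \<exists>g \<in> rmodule_hom R B E. \<forall>x\<in>A. g x = f x))"

definition essential_rsubmodule ::
    "'b set \<Rightarrow> ('a, 'm) ring_scheme \<Rightarrow> ('a, 'b, 'n) rmodule_scheme \<Rightarrow> bool" where
  "essential_rsubmodule N R M \<longleftrightarrow>
     rsubmodule N R M \<and>
     (\<forall>K. rsubmodule K R M \<and> K \<inter> N = {\<zero>\<^bsub>M\<^esub>} \<longrightarrow> K = {\<zero>\<^bsub>M\<^esub>})"

definition injective_envelope ::
    "('a, 'm) ring_scheme \<Rightarrow> ('a, 'b, 'n) rmodule_scheme \<Rightarrow> ('a, 'c, 'k) rmodule_scheme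
      \<Rightarrow> ('b \<Rightarrow> 'c) \<Rightarrow> bool" where
  "injective_envelope R M E \<iota> \<longleftrightarrow>
     injective_rmodule R E \<and>
     \<iota> \<in> rmodule_hom R M E \<and> inj_on \<iota> (carrier M) \<and>
     essential_rsubmodule (\<iota> ` carrier M) R E"

text \<open>
  Injective envelopes of \<open>M\<close> are unique up to an isomorphism that commutes with the
  embeddings of \<open>M\<close>, so the condition on automorphisms does not depend on the envelope
  that is chosen.
\<close>

definition automorphism_invariant ::
    "('a, 'm) ring_scheme \<Rightarrow> ('a, 'b, 'n) rmodule_scheme \<Rightarrow> bool" where
  "automorphism_invariant R M \<longleftrightarrow>
     (\<exists>(E :: ('a, ('a, 'b) envelope_type) rmodule) \<iota>.
        injective_envelope R M E \<iota> \<and>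
        (\<forall>\<phi> \<in> rmodule_aut R E. \<phi> ` (\<iota> ` carrier M) \<subseteq> \<iota> ` carrier M))"

definition right_a_ring :: "('a, 'm) ring_scheme \<Rightarrow> bool" where
  "right_a_ring R \<longleftrightarrow>
     ring R \<and>
     (\<forall>I. right_ideal I R \<longrightarrow>
        automorphism_invariant R (restrict_rmodule (right_regular R) I))"


section \<open>Square-free and square-full modules\<close>

definition square_root_in ::
    "'b set \<Rightarrow> ('a, 'm) ring_scheme \<Rightarrow> ('a, 'b, 'n) rmodule_scheme \<Rightarrow> bool" where
  "square_root_in N R M \<longleftrightarrow>
     rsubmodule N R M \<and>
     rmodule_embeds R (rmodule_sum (restrict_rmodule M N) (restrict_rmodule M N)) M"

definition square_free_rmodule ::
    "('a, 'm) ring_scheme \<Rightarrow> ('a, 'b, 'n) rmodule_scheme \<Rightarrow> bool" where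
  "square_free_rmodule R M \<longleftrightarrow> (\<forall>N. square_root_in N R M \<longrightarrow> N = {\<zero>\<^bsub>M\<^esub>})"

definition square_full_rmodule ::
    "('a, 'm) ring_scheme \<Rightarrow> ('a, 'b, 'n) rmodule_scheme \<Rightarrow> bool" where
  "square_full_rmodule R M \<longleftrightarrow>
     (\<forall>N. rsubmodule N R M \<and> N \<noteq> {\<zero>\<^bsub>M\<^esub>} \<longrightarrow>
        (\<exists>K \<subseteq> N. K \<noteq> {\<zero>\<^bsub>M\<^esub>} \<and> square_root_in K R M))"

definition right_square_free_ring :: "('a, 'm) ring_scheme \<Rightarrow> bool" where
  "right_square_free_ring R \<longleftrightarrow> ring R \<and> square_free_rmodule R (right_regular R)"


section \<open>Semisimple artinian rings\<close>

definition semisimple_rmodule ::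
    "('a, 'm) ring_scheme \<Rightarrow> ('a, 'b, 'n) rmodule_scheme \<Rightarrow> bool" where
  "semisimple_rmodule R M \<longleftrightarrow>
     (\<forall>N. rsubmodule N R M \<longrightarrow>
        (\<exists>K. rsubmodule K R M \<and> N \<inter> K = {\<zero>\<^bsub>M\<^esub>} \<and> N <+>\<^bsub>M\<^esub> K = carrier M))"

definition artinian_rmodule ::
    "('a, 'm) ring_scheme \<Rightarrow> ('a, 'b, 'n) rmodule_scheme \<Rightarrow> bool" where
  "artinian_rmodule R M \<longleftrightarrow>
     (\<forall>N :: nat \<Rightarrow> 'b set.
        (\<forall>n. rsubmodule (N n) R M \<and> N (Suc n) \<subseteq> N n) \<longrightarrow> (\<exists>n. \<forall>m\<ge>n. N m = N n))"

definition semisimple_artinian_ring :: "('a, 'm) ring_scheme \<Rightarrow> bool" where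
  "semisimple_artinian_ring R \<longleftrightarrow>
     ring R \<and> semisimple_rmodule R (right_regular R) \<and> artinian_rmodule R (right_regular R)"

end

theory Submission
  imports Defs
begin

text \<open>
  The hypothesis is used only through one consequence: if a right ideal \<open>N\<close> is essential in a right
  ideal \<open>I\<close>, then every automorphism of \<open>N\<close> extends to an endomorphism of \<open>I\<close>
  (\<open>a_ring_automorphism_extends\<close>).  Indeed \<open>N\<close> is essential in the injective envelope of \<open>I\<close>, so the
  automorphism extends to an automorphism of the envelope, and that one maps \<open>I\<close> into itself.
  Everything after this takes place inside the ring.

  The automorphisms that matter are the transvections \<open>a + c \<mapsto> (a + \<tau> c) + c\<close> of a direct sum
  \<open>A + C\<close> of right ideals.  Extending them shows that right ideals \<open>A\<close> and \<open>B\<close> with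
  \<open>A \<inter> B = 0\<close> are injective relative to each other (\<open>relatively_injective\<close>).  Let now \<open>A\<close> and
  \<open>A'\<close> be isomorphic with \<open>A \<inter> A' = 0\<close>.  Every right ideal \<open>X \<subseteq> A\<close> is injective relative to
  \<open>A' \<cong> A\<close>, hence a direct summand of \<open>A\<close>; so \<open>A\<close> is semisimple (\<open>square_semisimple\<close>).
  Moreover the projection onto \<open>A\<close> is a composition of two maps of the form \<open>transvection - 1\<close>,
  which leads to an idempotent \<open>e\<close> with \<open>A = eR\<close> and \<open>eA' = 0\<close> (\<open>square_summand\<close>).

  Zorn's lemma gives a maximal pair \<open>A = eR \<cong> A' = e'R\<close> of this kind.  By maximality, the right
  ideal \<open>K = (1 - e - e')R\<close> contains no nonzero square.  It may still contain right ideals that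
  embed in \<open>A\<close>; a maximal one among them has the form \<open>L = lR\<close>, again by \<open>square_summand\<close>.  Put
  \<open>h = e + e' + l\<close>.  A nonzero map from \<open>A\<close> to \<open>(1 - h)R\<close> is injective on a nonzero summand of the
  semisimple \<open>A\<close>, and would either enlarge \<open>L\<close> or produce a square in \<open>K\<close>; hence
  \<open>(1 - h)Re = 0\<close>.  The image of a map from \<open>(1 - h)R\<close> to \<open>A\<close> is a summand of \<open>A\<close>, so it is
  projective and the map splits, which yields a map in the direction just excluded; hence
  \<open>eR(1 - h) = 0\<close>.  Since \<open>e'\<close> and \<open>l\<close> lie in \<open>ReR\<close>, it follows that \<open>h\<close> is central.

  Therefore \<open>R\<close> is the product of the rings \<open>S = hR\<close> and \<open>T = (1 - h)R\<close>.  The first is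
  \<open>A + A' + L\<close>, which is semisimple; each of its nonzero right ideals has a nonzero map to \<open>A\<close> and
  so contains a nonzero copy of a right ideal of \<open>A\<close>, which is a square root because of \<open>A'\<close>.  The
  second is contained in \<open>K\<close>, so it is square-free.
\<close>

section \<open>Automorphisms of essential submodules of injective modules\<close>

text \<open>
  Multiplication by \<open>-1\<close> makes closure under additive inverses automatic.
\<close>

lemma (in rmodule) rsubmodule_iff:
  "rsubmodule N R M \<longleftrightarrow> N \<subseteq> carrier M \<and> \<zero>\<^bsub>M\<^esub> \<in> N \<and>
     (\<forall>x\<in>N. \<forall>y\<in>N. x \<oplus>\<^bsub>M\<^esub> y \<in> N) \<and> (\<forall>x\<in>N. \<forall>r\<in>carrier R. x \<bullet>\<^bsub>M\<^esub> r \<in> N)"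
proof
  assume "rsubmodule N R M"
  then have a: "additive_subgroup N M" and s: "\<forall>x\<in>N. \<forall>r\<in>carrier R. x \<bullet>\<^bsub>M\<^esub> r \<in> N"
    by (auto simp: rsubmodule_def)
  then show "N \<subseteq> carrier M \<and> \<zero>\<^bsub>M\<^esub> \<in> N \<and>
     (\<forall>x\<in>N. \<forall>y\<in>N. x \<oplus>\<^bsub>M\<^esub> y \<in> N) \<and> (\<forall>x\<in>N. \<forall>r\<in>carrier R. x \<bullet>\<^bsub>M\<^esub> r \<in> N)"
    using additive_subgroup.a_subset[OF a] additive_subgroup.zero_closed[OF a]
      additive_subgroup.a_closed[OF a] by auto
next
  assume N: "N \<subseteq> carrier M \<and> \<zero>\<^bsub>M\<^esub> \<in> N \<and>
     (\<forall>x\<in>N. \<forall>y\<in>N. x \<oplus>\<^bsub>M\<^esub> y \<in> N) \<and> (\<forall>x\<in>N. \<forall>r\<in>carrier R. x \<bullet>\<^bsub>M\<^esub> r \<in> N)"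
  have neg: "\<ominus>\<^bsub>M\<^esub> x \<in> N" if x: "x \<in> N" for x
  proof -
    have xM: "x \<in> carrier M" using x N by auto
    have z: "x \<bullet>\<^bsub>M\<^esub> \<zero>\<^bsub>R\<^esub> = \<zero>\<^bsub>M\<^esub>"
      using rsmult_add_right[OF xM R.zero_closed R.zero_closed] rsmult_closed[OF xM R.zero_closed]
      by (metis M.add.l_cancel_one R.add.l_one R.zero_closed)
    have "x \<oplus>\<^bsub>M\<^esub> x \<bullet>\<^bsub>M\<^esub> (\<ominus>\<^bsub>R\<^esub> \<one>\<^bsub>R\<^esub>) = \<zero>\<^bsub>M\<^esub>"
      using rsmult_add_right[OF xM R.one_closed R.a_inv_closed[OF R.one_closed]]
        rsmult_one[OF xM] z by (simp add: R.r_neg)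
    then have "\<ominus>\<^bsub>M\<^esub> x = x \<bullet>\<^bsub>M\<^esub> (\<ominus>\<^bsub>R\<^esub> \<one>\<^bsub>R\<^esub>)"
      using xM rsmult_closed[OF xM] by (metis M.minus_equality M.add.m_comm R.a_inv_closed R.one_closed)
    then show ?thesis using x N by auto
  qed
  have "subgroup N (add_monoid M)"
    by (rule group.subgroupI) (use N neg in \<open>auto simp: M.a_group simp flip: a_inv_def\<close>)
  then show "rsubmodule N R M"
    using N by (auto simp: rsubmodule_def intro: additive_subgroupI)
qed

lemma (in rmodule) rsmult_zero_left:
  assumes "r \<in> carrier R" shows "\<zero>\<^bsub>M\<^esub> \<bullet>\<^bsub>M\<^esub> r = \<zero>\<^bsub>M\<^esub>"
  using rsmult_add_left[OF M.zero_closed M.zero_closed assms] rsmult_closed[OF M.zero_closed assms]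
  by (metis M.add.l_cancel_one M.add.l_one M.zero_closed)

lemma rmodule_hom_zero:
  assumes "rmodule R M" "rmodule R N" "f \<in> rmodule_hom R M N"
  shows "f \<zero>\<^bsub>M\<^esub> = \<zero>\<^bsub>N\<^esub>"
proof -
  interpret M: rmodule R M by fact
  interpret N: rmodule R N by fact
  have "f \<zero>\<^bsub>M\<^esub> \<in> carrier N"
    using assms(3) unfolding rmodule_hom_def by auto
  moreover have "f (\<zero>\<^bsub>M\<^esub> \<oplus>\<^bsub>M\<^esub> \<zero>\<^bsub>M\<^esub>) = f \<zero>\<^bsub>M\<^esub> \<oplus>\<^bsub>N\<^esub> f \<zero>\<^bsub>M\<^esub>"
    using assms(3) M.M.zero_closed unfolding rmodule_hom_def by blast
  ultimately show ?thesis
    by (metis N.M.add.l_cancel_one M.M.add.l_one M.M.zero_closed)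
qed

lemma rmodule_hom_diff_zero:
  assumes "rmodule R M" "rmodule R N" "f \<in> rmodule_hom R M N"
    and "x \<in> carrier M" "y \<in> carrier M" "f x = f y"
  shows "f (x \<ominus>\<^bsub>M\<^esub> y) = \<zero>\<^bsub>N\<^esub>"
proof -
  interpret M: rmodule R M by fact
  interpret N: rmodule R N by fact
  have f: "f y \<in> carrier N" "f (\<ominus>\<^bsub>M\<^esub> y) \<in> carrier N"
    "f (x \<oplus>\<^bsub>M\<^esub> \<ominus>\<^bsub>M\<^esub> y) = f x \<oplus>\<^bsub>N\<^esub> f (\<ominus>\<^bsub>M\<^esub> y)" "f (y \<oplus>\<^bsub>M\<^esub> \<ominus>\<^bsub>M\<^esub> y) = f y \<oplus>\<^bsub>N\<^esub> f (\<ominus>\<^bsub>M\<^esub> y)"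
    using assms(3-5) unfolding rmodule_hom_def by auto
  then show ?thesis
    using assms(4-6) rmodule_hom_zero[OF assms(1-3)] by (simp add: a_minus_def M.M.r_neg)
qed

text \<open>
  A nonzero kernel would meet the essential submodule.
\<close>

lemma rmodule_hom_inj_if_inj_on_essential:
  assumes M: "rmodule R M" "rmodule R N" and f: "f \<in> rmodule_hom R M N"
    and ess: "essential_rsubmodule U R M" and U: "\<And>x. x \<in> U \<Longrightarrow> f x = \<zero>\<^bsub>N\<^esub> \<Longrightarrow> x = \<zero>\<^bsub>M\<^esub>"
  shows "inj_on f (carrier M)"
proof -
  interpret M: rmodule R M by fact
  interpret N: rmodule R N by fact
  let ?K = "{x \<in> carrier M. f x = \<zero>\<^bsub>N\<^esub>}"
  have z: "f \<zero>\<^bsub>M\<^esub> = \<zero>\<^bsub>N\<^esub>" by (rule rmodule_hom_zero[OF M f])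
  have "rsubmodule ?K R M"
    unfolding M.rsubmodule_iff
  proof (intro conjI ballI)
    show "?K \<subseteq> carrier M" "\<zero>\<^bsub>M\<^esub> \<in> ?K" using z by auto
    fix x assume x: "x \<in> ?K"
    show "x \<oplus>\<^bsub>M\<^esub> y \<in> ?K" if "y \<in> ?K" for y
      using x that f unfolding rmodule_hom_def by simp
    show "x \<bullet>\<^bsub>M\<^esub> r \<in> ?K" if "r \<in> carrier R" for r
      using x that f M.rsmult_closed[of x r] N.rsmult_zero_left[of r] unfolding rmodule_hom_def by simp
  qed
  moreover have "\<zero>\<^bsub>M\<^esub> \<in> U"
    using ess M.rsubmodule_iff by (auto simp: essential_rsubmodule_def)
  then have "?K \<inter> U = {\<zero>\<^bsub>M\<^esub>}" using U z M.M.zero_closed by blast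
  ultimately have K: "?K = {\<zero>\<^bsub>M\<^esub>}" using ess by (auto simp: essential_rsubmodule_def)
  show ?thesis
  proof (rule inj_onI)
    fix x y assume xy: "x \<in> carrier M" "y \<in> carrier M" "f x = f y"
    have "x \<ominus>\<^bsub>M\<^esub> y \<in> ?K" using rmodule_hom_diff_zero[OF M f xy] xy by simp
    then have "x \<ominus>\<^bsub>M\<^esub> y = \<zero>\<^bsub>M\<^esub>" using K by blast
    then show "x = y"
      using xy M.M.minus_equality[of x "\<ominus>\<^bsub>M\<^esub> y"] by (simp add: a_minus_def)
  qed
qed

text \<open>
  Injectivity extends \<open>u\<close> to an endomorphism \<open>g\<close> of \<open>E\<close>, which is injective because \<open>u\<close> is injective
  on an essential submodule.  Injectivity, applied to the submodule \<open>g E\<close>, also gives a left inverse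
  \<open>w\<close> of \<open>g\<close>.  Since \<open>g E\<close> contains \<open>u U = U\<close>, the map \<open>w\<close> is injective for the same reason as
  \<open>g\<close>, and an injective left inverse is a two-sided inverse.
\<close>

lemma automorphism_extends_from_essential:
  fixes R :: "('a, 'm) ring_scheme" and E :: "('a, ('a, 'a) envelope_type) rmodule"
  assumes inj: "injective_rmodule R E" and ess: "essential_rsubmodule U R E"
    and u: "u \<in> rmodule_aut R (restrict_rmodule E U)"
  obtains \<phi> where "\<phi> \<in> rmodule_aut R E" "\<And>x. x \<in> U \<Longrightarrow> \<phi> x = u x"
proof -
  have E: "rmodule R E" using inj by (simp add: injective_rmodule_def)
  interpret E: rmodule R E by (rule E)
  have ext: "\<exists>g \<in> rmodule_hom R E E. \<forall>x\<in>A. g x = f x"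
    if "rsubmodule A R E" "f \<in> rmodule_hom R (restrict_rmodule E A) E" for A f
    using inj that E unfolding injective_rmodule_def by blast
  have sub: "rsubmodule U R E" using ess by (simp add: essential_rsubmodule_def)
  then have Us: "U \<subseteq> carrier E" "\<zero>\<^bsub>E\<^esub> \<in> U" by (auto simp: E.rsubmodule_iff)
  have bij: "bij_betw u U U" and uh: "u \<in> rmodule_hom R (restrict_rmodule E U) (restrict_rmodule E U)"
    using u by (auto simp: rmodule_aut_def)
  have "u \<in> rmodule_hom R (restrict_rmodule E U) E"
    using uh Us unfolding rmodule_hom_def by auto
  then obtain g where g: "g \<in> rmodule_hom R E E" and gu: "\<And>x. x \<in> U \<Longrightarrow> g x = u x"
    using ext[OF sub, of u] by blast
  have gz: "g \<zero>\<^bsub>E\<^esub> = \<zero>\<^bsub>E\<^esub>" by (rule rmodule_hom_zero[OF E E g])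
  have ginj: "inj_on g (carrier E)"
  proof (rule rmodule_hom_inj_if_inj_on_essential[OF E E g ess])
    fix x assume "x \<in> U" "g x = \<zero>\<^bsub>E\<^esub>"
    then show "x = \<zero>\<^bsub>E\<^esub>" using gu gz Us bij by (metis bij_betw_def inj_onD)
  qed
  let ?V = "g ` carrier E"
  let ?v = "inv_into (carrier E) g"
  have V: "rsubmodule ?V R E"
    unfolding E.rsubmodule_iff
  proof (intro conjI ballI)
    show "?V \<subseteq> carrier E" using g by (auto simp: rmodule_hom_def)
    show "\<zero>\<^bsub>E\<^esub> \<in> ?V" using gz by (metis E.M.zero_closed imageI)
    fix x assume x: "x \<in> ?V"
    show "x \<oplus>\<^bsub>E\<^esub> y \<in> ?V" if "y \<in> ?V" for y
      using x that g unfolding rmodule_hom_def by (auto simp: image_iff) (metis E.M.a_closed)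
    show "x \<bullet>\<^bsub>E\<^esub> r \<in> ?V" if "r \<in> carrier R" for r
      using x that g unfolding rmodule_hom_def by (auto simp: image_iff) (metis E.rsmult_closed)
  qed
  have vg: "?v (g x) = x" if "x \<in> carrier E" for x using ginj that by simp
  have "?v \<in> rmodule_hom R (restrict_rmodule E ?V) E"
    unfolding rmodule_hom_def
  proof (simp, intro conjI ballI)
    show "?v \<in> ?V \<rightarrow> carrier E" using vg by auto
    fix x assume x: "x \<in> carrier E"
    show "?v (g x \<oplus>\<^bsub>E\<^esub> g y) = ?v (g x) \<oplus>\<^bsub>E\<^esub> ?v (g y)" if y: "y \<in> carrier E" for y
    proof -
      have "g x \<oplus>\<^bsub>E\<^esub> g y = g (x \<oplus>\<^bsub>E\<^esub> y)" using g x y by (simp add: rmodule_hom_def)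
      then show ?thesis using x y vg by simp
    qed
    show "?v (g x \<bullet>\<^bsub>E\<^esub> r) = ?v (g x) \<bullet>\<^bsub>E\<^esub> r" if r: "r \<in> carrier R" for r
    proof -
      have "g x \<bullet>\<^bsub>E\<^esub> r = g (x \<bullet>\<^bsub>E\<^esub> r)" using g x r by (simp add: rmodule_hom_def)
      then show ?thesis using x r vg E.rsmult_closed by simp
    qed
  qed
  then obtain w where w: "w \<in> rmodule_hom R E E" and wv: "\<And>x. x \<in> ?V \<Longrightarrow> w x = ?v x"
    using ext[OF V, of ?v] by blast
  have wg: "w (g x) = x" if "x \<in> carrier E" for x using wv vg that by auto
  have winj: "inj_on w (carrier E)"
  proof (rule rmodule_hom_inj_if_inj_on_essential[OF E E w ess])
    fix x assume x: "x \<in> U" "w x = \<zero>\<^bsub>E\<^esub>"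
    then obtain y where y: "y \<in> U" "x = g y" using bij gu by (metis bij_betw_def imageE)
    then show "x = \<zero>\<^bsub>E\<^esub>" using wg[of y] Us x gz by auto
  qed
  have gw: "g (w x) = x" if x: "x \<in> carrier E" for x
  proof -
    have wx: "w x \<in> carrier E" using w x by (auto simp: rmodule_hom_def)
    then have gx: "g (w x) \<in> carrier E" using g by (auto simp: rmodule_hom_def)
    show ?thesis by (rule inj_onD[OF winj wg[OF wx] gx x])
  qed
  have "bij_betw g (carrier E) (carrier E)"
    unfolding bij_betw_def
  proof (intro conjI subset_antisym subsetI ginj)
    fix x assume "x \<in> carrier E"
    then show "x \<in> ?V" using gw[of x] w unfolding rmodule_hom_def by (metis (mono_tags, lifting) Pi_mem image_eqI mem_Collect_eq)
  qed (use g in \<open>auto simp: rmodule_hom_def\<close>)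
  then have "g \<in> rmodule_aut R E" using g by (simp add: rmodule_aut_def)
  then show ?thesis using gu that by blast
qed

section \<open>Right ideals of a right a-ring\<close>

context ring
begin

lemma rmodule_right_regular: "rmodule R (right_regular R)"
proof -
  have "abelian_group (right_regular R)"
    by (rule abelian_groupI) (auto simp: right_regular_def a_ac intro: add.l_inv_ex)
  moreover have "ring R" by (rule ring_axioms)
  ultimately show ?thesis
    by (intro rmodule.intro rmodule_axioms.intro)
       (auto simp: right_regular_def l_distr r_distr m_assoc)
qed

lemma right_ideal_iff:
  "right_ideal I R \<longleftrightarrow> I \<subseteq> carrier R \<and> \<zero> \<in> I \<and> (\<forall>x\<in>I. \<forall>y\<in>I. x \<oplus> y \<in> I) \<and>
     (\<forall>x\<in>I. \<forall>r\<in>carrier R. x \<otimes> r \<in> I)"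
  using rmodule.rsubmodule_iff[OF rmodule_right_regular] by (simp add: right_regular_def)

lemma rmodule_right_ideal:
  assumes "right_ideal I R" shows "rmodule R (restrict_rmodule (right_regular R) I)"
proof -
  let ?I = "restrict_rmodule (right_regular R) I"
  have I: "I \<subseteq> carrier R" "\<zero> \<in> I" "\<And>x y. x \<in> I \<Longrightarrow> y \<in> I \<Longrightarrow> x \<oplus> y \<in> I"
    "\<And>x r. x \<in> I \<Longrightarrow> r \<in> carrier R \<Longrightarrow> x \<otimes> r \<in> I"
    using assms by (auto simp: right_ideal_iff)
  have "abelian_group ?I"
  proof (rule abelian_groupI)
    fix x assume "x \<in> carrier ?I"
    then have x: "x \<in> I" "x \<in> carrier R" using I by auto
    have "x \<otimes> (\<ominus> \<one>) \<in> I" by (rule I(4)) (use x in auto)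
    moreover have "x \<otimes> (\<ominus> \<one>) \<oplus> x = \<zero>"
      using x by (simp add: r_minus l_neg)
    ultimately show "\<exists>y\<in>carrier ?I. y \<oplus>\<^bsub>?I\<^esub> x = \<zero>\<^bsub>?I\<^esub>" by (auto simp: right_regular_def)
  qed (use I in \<open>auto simp: right_regular_def a_ac subset_iff\<close>)
  moreover have "ring R" by (rule ring_axioms)
  ultimately show ?thesis
    using I by (intro rmodule.intro rmodule_axioms.intro)
       (auto simp: right_regular_def l_distr r_distr m_assoc subset_iff)
qed

definition right_linear :: "'a set \<Rightarrow> 'a set \<Rightarrow> ('a \<Rightarrow> 'a) \<Rightarrow> bool" where
  "right_linear A B f \<longleftrightarrow> f \<in> A \<rightarrow> B \<and> (\<forall>x\<in>A. \<forall>y\<in>A. f (x \<oplus> y) = f x \<oplus> f y) \<and>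
     (\<forall>x\<in>A. \<forall>r\<in>carrier R. f (x \<otimes> r) = f x \<otimes> r)"

text \<open>
  Essentiality relative to a right ideal \<open>I\<close>, with \<open>I\<close> a subset of the ring instead of a module of
  its own.
\<close>

definition essential_in :: "'a set \<Rightarrow> 'a set \<Rightarrow> bool" where
  "essential_in N I \<longleftrightarrow> N \<subseteq> I \<and> right_ideal N R \<and>
     (\<forall>J. right_ideal J R \<and> J \<subseteq> I \<and> J \<inter> N = {\<zero>} \<longrightarrow> J = {\<zero>})"

text \<open>
  The image of \<open>N\<close> is essential in the image of \<open>I\<close> and hence in the envelope \<open>E\<close> of \<open>I\<close>.  An
  automorphism of \<open>N\<close> therefore extends to one of \<open>E\<close>, and \<open>I\<close> is invariant under the latter.
\<close>

lemma a_ring_automorphism_extends: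
  assumes "right_a_ring R" and I: "right_ideal I R" and N: "essential_in N I"
    and u: "right_linear N N u" "bij_betw u N N"
  obtains w where "right_linear I I w" "\<And>x. x \<in> N \<Longrightarrow> w x = u x"
proof -
  let ?M = "restrict_rmodule (right_regular R) I"
  have "automorphism_invariant R ?M" using assms by (simp add: right_a_ring_def)
  then obtain E :: "('a, ('a, 'a) envelope_type) rmodule" and \<iota>
    where env: "injective_envelope R ?M E \<iota>"
      and inv: "\<And>\<phi>. \<phi> \<in> rmodule_aut R E \<Longrightarrow> \<phi> ` (\<iota> ` I) \<subseteq> \<iota> ` I"
    unfolding automorphism_invariant_def by auto
  have inj: "injective_rmodule R E" and \<iota>: "\<iota> \<in> rmodule_hom R ?M E" and \<iota>i: "inj_on \<iota> I"
    and ess: "essential_rsubmodule (\<iota> ` I) R E"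
    using env by (auto simp: injective_envelope_def)
  have E: "rmodule R E" using inj by (simp add: injective_rmodule_def)
  interpret E: rmodule R E by (rule E)
  have M: "rmodule R ?M" by (rule rmodule_right_ideal[OF I])
  have \<iota>h: "\<And>x. x \<in> I \<Longrightarrow> \<iota> x \<in> carrier E" "\<And>x y. x \<in> I \<Longrightarrow> y \<in> I \<Longrightarrow> \<iota> (x \<oplus> y) = \<iota> x \<oplus>\<^bsub>E\<^esub> \<iota> y"
    "\<And>x r. x \<in> I \<Longrightarrow> r \<in> carrier R \<Longrightarrow> \<iota> (x \<otimes> r) = \<iota> x \<bullet>\<^bsub>E\<^esub> r"
    using \<iota> by (auto simp: rmodule_hom_def right_regular_def)
  have \<iota>z: "\<iota> \<zero> = \<zero>\<^bsub>E\<^esub>" using rmodule_hom_zero[OF M E \<iota>] by (simp add: right_regular_def)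
  have Is: "I \<subseteq> carrier R" "\<zero> \<in> I" "\<And>x y. x \<in> I \<Longrightarrow> y \<in> I \<Longrightarrow> x \<oplus> y \<in> I"
    "\<And>x r. x \<in> I \<Longrightarrow> r \<in> carrier R \<Longrightarrow> x \<otimes> r \<in> I"
    using I by (auto simp: right_ideal_iff)
  have Nr: "right_ideal N R" and NI: "N \<subseteq> I" using N by (auto simp: essential_in_def)
  have Ns: "\<zero> \<in> N" "\<And>x. x \<in> N \<Longrightarrow> x \<in> I" "\<And>x y. x \<in> N \<Longrightarrow> y \<in> N \<Longrightarrow> x \<oplus> y \<in> N"
    "\<And>x r. x \<in> N \<Longrightarrow> r \<in> carrier R \<Longrightarrow> x \<otimes> r \<in> N"
    using Nr NI by (auto simp: right_ideal_iff)
  let ?j = "inv_into I \<iota>"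
  have j: "?j (\<iota> x) = x" if "x \<in> I" for x using \<iota>i that by simp
  have sub: "rsubmodule (\<iota> ` N) R E"
    unfolding E.rsubmodule_iff
  proof (intro conjI ballI)
    show "\<iota> ` N \<subseteq> carrier E" using \<iota>h NI by auto
    show "\<zero>\<^bsub>E\<^esub> \<in> \<iota> ` N" using \<iota>z Ns by (metis imageI)
    fix x assume "x \<in> \<iota> ` N"
    then obtain x' where x: "x' \<in> N" "x = \<iota> x'" by auto
    show "x \<oplus>\<^bsub>E\<^esub> y \<in> \<iota> ` N" if "y \<in> \<iota> ` N" for y
    proof -
      obtain y' where y: "y' \<in> N" "y = \<iota> y'" using \<open>y \<in> \<iota> ` N\<close> by auto
      have "x \<oplus>\<^bsub>E\<^esub> y = \<iota> (x' \<oplus> y')" using x y \<iota>h Ns by simp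
      then show ?thesis using Ns x y by auto
    qed
    show "x \<bullet>\<^bsub>E\<^esub> r \<in> \<iota> ` N" if "r \<in> carrier R" for r
    proof -
      have "x \<bullet>\<^bsub>E\<^esub> r = \<iota> (x' \<otimes> r)" using x that \<iota>h Ns by simp
      then show ?thesis using Ns x that by auto
    qed
  qed
  \<comment> \<open>Essentiality is transitive: \<open>K\<close> meets the image of \<open>I\<close> in the image of the right ideal \<open>J\<close>.\<close>
  have Uess: "essential_rsubmodule (\<iota> ` N) R E"
    unfolding essential_rsubmodule_def
  proof (intro conjI sub allI impI)
    fix K assume "rsubmodule K R E \<and> K \<inter> \<iota> ` N = {\<zero>\<^bsub>E\<^esub>}"
    then have K: "rsubmodule K R E" and KN: "K \<inter> \<iota> ` N = {\<zero>\<^bsub>E\<^esub>}" by auto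
    have Ks: "\<zero>\<^bsub>E\<^esub> \<in> K" "\<And>x y. x \<in> K \<Longrightarrow> y \<in> K \<Longrightarrow> x \<oplus>\<^bsub>E\<^esub> y \<in> K"
      "\<And>x r. x \<in> K \<Longrightarrow> r \<in> carrier R \<Longrightarrow> x \<bullet>\<^bsub>E\<^esub> r \<in> K"
      using K by (auto simp: E.rsubmodule_iff)
    let ?J = "{x \<in> I. \<iota> x \<in> K}"
    have "right_ideal ?J R"
      unfolding right_ideal_iff using Is \<iota>z \<iota>h Ks by auto
    moreover have "?J \<inter> N = {\<zero>}"
    proof -
      have "x = \<zero>" if "x \<in> I" "\<iota> x \<in> K" "x \<in> N" for x
      proof -
        have "\<iota> x \<in> K \<inter> \<iota> ` N" using that by auto
        then have "\<iota> x = \<iota> \<zero>" using KN \<iota>z by auto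
        then show ?thesis using \<iota>i that Is by (auto dest: inj_onD)
      qed
      then show ?thesis using Is Ns \<iota>z Ks by auto
    qed
    ultimately have J: "?J = {\<zero>}" using N unfolding essential_in_def by blast
    have "K \<inter> \<iota> ` I = {\<zero>\<^bsub>E\<^esub>}"
    proof -
      have "y = \<zero>\<^bsub>E\<^esub>" if y: "y \<in> K \<inter> \<iota> ` I" for y
      proof -
        obtain x where "x \<in> I" "y = \<iota> x" using y by auto
        then have "x \<in> ?J" using y by auto
        then have "x = \<zero>" using J by auto
        then show ?thesis using \<open>y = \<iota> x\<close> \<iota>z by simp
      qed
      moreover have "\<zero>\<^bsub>E\<^esub> \<in> \<iota> ` I" using \<iota>z Is by (metis imageI)
      ultimately show ?thesis using Ks by blast
    qed
    then show "K = {\<zero>\<^bsub>E\<^esub>}" using ess K by (auto simp: essential_rsubmodule_def)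
  qed
  let ?u = "\<lambda>y. \<iota> (u (?j y))"
  have us: "\<And>x. x \<in> N \<Longrightarrow> u x \<in> N" "\<And>x y. x \<in> N \<Longrightarrow> y \<in> N \<Longrightarrow> u (x \<oplus> y) = u x \<oplus> u y"
    "\<And>x r. x \<in> N \<Longrightarrow> r \<in> carrier R \<Longrightarrow> u (x \<otimes> r) = u x \<otimes> r"
    using u by (auto simp: right_linear_def)
  have uj: "?u (\<iota> x) = \<iota> (u x)" if "x \<in> N" for x using j that NI by auto
  have uadd: "?u (\<iota> x \<oplus>\<^bsub>E\<^esub> \<iota> y) = ?u (\<iota> x) \<oplus>\<^bsub>E\<^esub> ?u (\<iota> y)" if "x \<in> N" "y \<in> N" for x y
  proof -
    have "\<iota> x \<oplus>\<^bsub>E\<^esub> \<iota> y = \<iota> (x \<oplus> y)" using that \<iota>h Ns by simp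
    then have "?u (\<iota> x \<oplus>\<^bsub>E\<^esub> \<iota> y) = \<iota> (u x \<oplus> u y)" using uj[of "x \<oplus> y"] that us Ns by auto
    then show ?thesis using uj that \<iota>h us Ns by simp
  qed
  have usm: "?u (\<iota> x \<bullet>\<^bsub>E\<^esub> r) = ?u (\<iota> x) \<bullet>\<^bsub>E\<^esub> r" if "x \<in> N" "r \<in> carrier R" for x r
  proof -
    have "\<iota> x \<bullet>\<^bsub>E\<^esub> r = \<iota> (x \<otimes> r)" using that \<iota>h Ns by simp
    then have "?u (\<iota> x \<bullet>\<^bsub>E\<^esub> r) = \<iota> (u x \<otimes> r)" using uj[of "x \<otimes> r"] that us Ns by auto
    then show ?thesis using uj that \<iota>h us Ns by simp
  qed
  have "bij_betw ?u (\<iota> ` N) (\<iota> ` N)"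
  proof -
    have "bij_betw \<iota> N (\<iota> ` N)" using \<iota>i NI by (meson bij_betw_imageI inj_on_subset)
    moreover have "bij_betw ?j (\<iota> ` N) N"
      by (rule bij_betwI[where g = \<iota>]) (use j NI in auto)
    ultimately have "bij_betw (\<iota> \<circ> (u \<circ> ?j)) (\<iota> ` N) (\<iota> ` N)"
      using u(2) by (blast intro: bij_betw_trans)
    then show ?thesis by (simp add: comp_def)
  qed
  then have "?u \<in> rmodule_aut R (restrict_rmodule E (\<iota> ` N))"
    unfolding rmodule_aut_def rmodule_hom_def using uadd usm uj us by auto
  then obtain \<phi> where \<phi>: "\<phi> \<in> rmodule_aut R E" and \<phi>u: "\<And>x. x \<in> \<iota> ` N \<Longrightarrow> \<phi> x = ?u x"
    using automorphism_extends_from_essential[OF inj Uess] by blast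
  have \<phi>h: "\<And>x y. x \<in> carrier E \<Longrightarrow> y \<in> carrier E \<Longrightarrow> \<phi> (x \<oplus>\<^bsub>E\<^esub> y) = \<phi> x \<oplus>\<^bsub>E\<^esub> \<phi> y"
    "\<And>x r. x \<in> carrier E \<Longrightarrow> r \<in> carrier R \<Longrightarrow> \<phi> (x \<bullet>\<^bsub>E\<^esub> r) = \<phi> x \<bullet>\<^bsub>E\<^esub> r"
    using \<phi> by (auto simp: rmodule_aut_def rmodule_hom_def)
  define w where "w x = ?j (\<phi> (\<iota> x))" for x
  have w: "w x \<in> I" "\<iota> (w x) = \<phi> (\<iota> x)" if "x \<in> I" for x
  proof -
    have "\<phi> (\<iota> x) \<in> \<iota> ` I" using inv[OF \<phi>] that by auto
    then show "w x \<in> I" "\<iota> (w x) = \<phi> (\<iota> x)"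
      unfolding w_def by (auto simp: inv_into_into f_inv_into_f)
  qed
  have weq: "w x = y" if "x \<in> I" "y \<in> I" "\<phi> (\<iota> x) = \<iota> y" for x y
    using w[OF that(1)] that \<iota>i by (auto dest: inj_onD)
  have "right_linear I I w"
    unfolding right_linear_def
    using w Is by (auto intro!: weq simp: \<iota>h \<phi>h)
  moreover have "w x = u x" if "x \<in> N" for x
    by (rule weq) (use that NI us \<phi>u uj in auto)
  ultimately show ?thesis using that by blast
qed

end

section \<open>Maximal sets under pairwise conditions\<close>

text \<open>
  The conditions on a right ideal or on the graph of a linear map involve at most two elements at a
  time: pairs satisfy a relation, and certain elements computed from a pair belong to the set again.
  Such conditions pass to unions of chains.
\<close>

definition pairwise_closed :: "('b \<Rightarrow> 'b \<Rightarrow> bool) \<Rightarrow> ('b \<Rightarrow> 'b \<Rightarrow> 'b set) \<Rightarrow> 'b set \<Rightarrow> bool" where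
  "pairwise_closed good ops F \<longleftrightarrow> (\<forall>p\<in>F. \<forall>q\<in>F. good p q \<and> ops p q \<subseteq> F)"

lemma maximal_pairwise_closed:
  assumes Z: "pairwise_closed good ops Z"
  shows "\<exists>M. Z \<subseteq> M \<and> pairwise_closed good ops M \<and>
    (\<forall>M'. M \<subseteq> M' \<longrightarrow> pairwise_closed good ops M' \<longrightarrow> M' = M)"
proof -
  let ?A = "{F. Z \<subseteq> F \<and> pairwise_closed good ops F}"
  have "\<exists>M\<in>?A. \<forall>X\<in>?A. M \<subseteq> X \<longrightarrow> X = M"
  proof (rule subset_Zorn_nonempty)
    show "?A \<noteq> {}" using Z by auto
    fix C assume ne: "C \<noteq> {}" and ch: "subset.chain ?A C"
    have C: "\<And>X. X \<in> C \<Longrightarrow> Z \<subseteq> X \<and> pairwise_closed good ops X"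
      and tot: "\<And>X Y. X \<in> C \<Longrightarrow> Y \<in> C \<Longrightarrow> X \<subseteq> Y \<or> Y \<subseteq> X"
      using ch unfolding subset_chain_def by blast+
    have "pairwise_closed good ops (\<Union>C)"
      unfolding pairwise_closed_def
    proof (intro ballI)
      fix p q assume "p \<in> \<Union>C" "q \<in> \<Union>C"
      then obtain X Y where "X \<in> C" "p \<in> X" "Y \<in> C" "q \<in> Y" by auto
      then obtain W where "W \<in> C" "p \<in> W" "q \<in> W" using tot[of X Y] by blast
      then show "good p q \<and> ops p q \<subseteq> \<Union>C" using C[of W] unfolding pairwise_closed_def by blast
    qed
    moreover have "Z \<subseteq> \<Union>C" using C ne by blast
    ultimately show "\<Union>C \<in> ?A" by simp
  qed
  then show ?thesis by (metis (no_types, lifting) mem_Collect_eq subset_trans)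
qed

section \<open>Sums, linear maps and complements of right ideals\<close>

context ring
begin

lemma eq_if_minus_zero:
  assumes "x \<in> carrier R" "y \<in> carrier R" "x \<ominus> y = \<zero>" shows "x = y"
  using assms minus_equality[of x "\<ominus> y"] by (simp add: a_minus_def)

lemma right_idealD:
  assumes "right_ideal I R"
  shows "x \<in> I \<Longrightarrow> x \<in> carrier R" "\<zero> \<in> I" "x \<in> I \<Longrightarrow> y \<in> I \<Longrightarrow> x \<oplus> y \<in> I"
    "x \<in> I \<Longrightarrow> r \<in> carrier R \<Longrightarrow> x \<otimes> r \<in> I" "x \<in> I \<Longrightarrow> \<ominus> x \<in> I"
    "x \<in> I \<Longrightarrow> y \<in> I \<Longrightarrow> x \<ominus> y \<in> I"
proof -
  show 1: "x \<in> I \<Longrightarrow> x \<in> carrier R" "\<zero> \<in> I" "x \<in> I \<Longrightarrow> r \<in> carrier R \<Longrightarrow> x \<otimes> r \<in> I" for x r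
    using assms by (auto simp: right_ideal_iff)
  show 2: "x \<in> I \<Longrightarrow> y \<in> I \<Longrightarrow> x \<oplus> y \<in> I" for x y
    using assms by (auto simp: right_ideal_iff)
  show 3: "x \<in> I \<Longrightarrow> \<ominus> x \<in> I" for x
    using 1(3)[of x "\<ominus> \<one>"] 1(1)[of x] by (simp add: r_minus)
  show "x \<in> I \<Longrightarrow> y \<in> I \<Longrightarrow> x \<ominus> y \<in> I"
    using 2 3 by (simp add: a_minus_def)
qed

lemma right_idealI:
  assumes "\<And>x. x \<in> I \<Longrightarrow> x \<in> carrier R" "\<zero> \<in> I" "\<And>x y. x \<in> I \<Longrightarrow> y \<in> I \<Longrightarrow> x \<oplus> y \<in> I"
    "\<And>x r. x \<in> I \<Longrightarrow> r \<in> carrier R \<Longrightarrow> x \<otimes> r \<in> I"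
  shows "right_ideal I R"
  using assms by (auto simp: right_ideal_iff)

lemma right_ideal_carrier: "right_ideal (carrier R) R"
  by (rule right_idealI) auto

lemma right_ideal_zero: "right_ideal {\<zero>} R"
  by (rule right_idealI) auto

lemma right_ideal_Int: "right_ideal A R \<Longrightarrow> right_ideal B R \<Longrightarrow> right_ideal (A \<inter> B) R"
  by (auto simp: right_ideal_iff)

lemma right_ideal_principal:
  assumes "x \<in> carrier R" shows "right_ideal ((\<otimes>) x ` carrier R) R"
proof (rule right_idealI)
  show "\<zero> \<in> (\<otimes>) x ` carrier R" using assms by (auto intro!: image_eqI[of _ _ \<zero>])
  fix y assume "y \<in> (\<otimes>) x ` carrier R"
  then obtain r where r: "r \<in> carrier R" "y = x \<otimes> r" by auto
  then show "y \<in> carrier R" using assms by auto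
  show "y \<oplus> z \<in> (\<otimes>) x ` carrier R" if "z \<in> (\<otimes>) x ` carrier R" for z
  proof -
    from that obtain s where "s \<in> carrier R" "z = x \<otimes> s" by auto
    then have "r \<oplus> s \<in> carrier R" "y \<oplus> z = x \<otimes> (r \<oplus> s)" using r assms by (auto simp: r_distr)
    then show ?thesis by blast
  qed
  show "y \<otimes> s \<in> (\<otimes>) x ` carrier R" if "s \<in> carrier R" for s
    using r assms that by (auto simp: m_assoc)
qed

lemma in_sumI: "a \<in> A \<Longrightarrow> b \<in> B \<Longrightarrow> a \<oplus> b \<in> A <+>\<^bsub>R\<^esub> B"
  by (auto simp: set_add_def')

lemma in_sumE:
  assumes "x \<in> A <+>\<^bsub>R\<^esub> B" obtains a b where "a \<in> A" "b \<in> B" "x = a \<oplus> b"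
  using assms by (auto simp: set_add_def')

lemma right_ideal_sum:
  assumes A: "right_ideal A R" and B: "right_ideal B R" shows "right_ideal (A <+>\<^bsub>R\<^esub> B) R"
proof (rule right_idealI)
  note a = right_idealD[OF A] and b = right_idealD[OF B]
  show "\<zero> \<in> A <+>\<^bsub>R\<^esub> B" using in_sumI[OF a(2) b(2)] by simp
  fix x assume "x \<in> A <+>\<^bsub>R\<^esub> B"
  then obtain p q where x: "p \<in> A" "q \<in> B" "x = p \<oplus> q" by (rule in_sumE)
  then have c: "p \<in> carrier R" "q \<in> carrier R" using a b by auto
  show "x \<in> carrier R" using x c by simp
  show "x \<oplus> y \<in> A <+>\<^bsub>R\<^esub> B" if y: "y \<in> A <+>\<^bsub>R\<^esub> B" for y
  proof -
    obtain s t where y: "s \<in> A" "t \<in> B" "y = s \<oplus> t" using y by (rule in_sumE)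
    then have "s \<in> carrier R" "t \<in> carrier R" using a b by auto
    then have "x \<oplus> y = (p \<oplus> s) \<oplus> (q \<oplus> t)" using x y c by (simp add: a_ac)
    then show ?thesis using in_sumI[OF a(3) b(3)] x y by simp
  qed
  show "x \<otimes> r \<in> A <+>\<^bsub>R\<^esub> B" if r: "r \<in> carrier R" for r
    using in_sumI[OF a(4) b(4)] x c r by (simp add: l_distr)
qed

lemma sum_upper:
  assumes A: "right_ideal A R" and B: "right_ideal B R" shows "A \<subseteq> A <+>\<^bsub>R\<^esub> B" "B \<subseteq> A <+>\<^bsub>R\<^esub> B"
proof -
  show "A \<subseteq> A <+>\<^bsub>R\<^esub> B"
    using in_sumI[OF _ right_idealD(2)[OF B], of _ A] right_idealD(1)[OF A] by force
  show "B \<subseteq> A <+>\<^bsub>R\<^esub> B"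
    using in_sumI[OF right_idealD(2)[OF A], of _ B] right_idealD(1)[OF B] by force
qed

lemma sum_least:
  assumes "right_ideal C R" "A \<subseteq> C" "B \<subseteq> C" shows "A <+>\<^bsub>R\<^esub> B \<subseteq> C"
  using assms right_idealD(3)[OF assms(1)] by (auto elim!: in_sumE)

lemma direct_sum_cancel:
  assumes A: "right_ideal A R" and B: "right_ideal B R" and d: "A \<inter> B = {\<zero>}"
    and x: "a \<in> A" "b \<in> B" "a' \<in> A" "b' \<in> B" "a \<oplus> b = a' \<oplus> b'"
  shows "a = a' \<and> b = b'"
proof -
  note c = right_idealD(1)[OF A x(1)] right_idealD(1)[OF B x(2)]
    right_idealD(1)[OF A x(3)] right_idealD(1)[OF B x(4)]
  have "a \<ominus> a' = b' \<ominus> b"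
  proof -
    have "a \<ominus> a' = (a \<oplus> b) \<oplus> (\<ominus> b \<oplus> \<ominus> a')" using c by (simp add: a_minus_def a_assoc r_neg2)
    also have "\<dots> = (b' \<oplus> a') \<oplus> (\<ominus> a' \<oplus> \<ominus> b)" using x c by (simp add: a_comm)
    also have "\<dots> = b' \<ominus> b" using c by (simp add: a_minus_def a_assoc r_neg2)
    finally show ?thesis .
  qed
  then have "a \<ominus> a' \<in> A \<inter> B" "b' \<ominus> b \<in> A \<inter> B"
    using right_idealD(6)[OF A x(1,3)] right_idealD(6)[OF B x(4,2)] by auto
  then have "a \<ominus> a' = \<zero>" "b' \<ominus> b = \<zero>" using d by auto
  then show ?thesis using eq_if_minus_zero c by metis
qed

lemma right_linearD:
  assumes "right_linear A B f"
  shows "x \<in> A \<Longrightarrow> f x \<in> B" "x \<in> A \<Longrightarrow> y \<in> A \<Longrightarrow> f (x \<oplus> y) = f x \<oplus> f y"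
    "x \<in> A \<Longrightarrow> r \<in> carrier R \<Longrightarrow> f (x \<otimes> r) = f x \<otimes> r"
  using assms by (auto simp: right_linear_def)

lemma right_linearI:
  assumes "\<And>x. x \<in> A \<Longrightarrow> f x \<in> B" "\<And>x y. x \<in> A \<Longrightarrow> y \<in> A \<Longrightarrow> f (x \<oplus> y) = f x \<oplus> f y"
    "\<And>x r. x \<in> A \<Longrightarrow> r \<in> carrier R \<Longrightarrow> f (x \<otimes> r) = f x \<otimes> r"
  shows "right_linear A B f"
  using assms by (auto simp: right_linear_def)

lemma right_linear_zero:
  assumes "right_linear A B f" "right_ideal A R" "right_ideal B R" shows "f \<zero> = \<zero>"
  using right_linearD(3)[OF assms(1) right_idealD(2)[OF assms(2)] zero_closed]
    right_idealD(1)[OF assms(3) right_linearD(1)[OF assms(1) right_idealD(2)[OF assms(2)]]]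
  by simp

lemma right_linear_minus:
  assumes "right_linear A B f" "right_ideal A R" "right_ideal B R" "x \<in> A"
  shows "f (\<ominus> x) = \<ominus> f x"
  using right_linearD(3)[OF assms(1,4), of "\<ominus> \<one>"] right_idealD(1)[OF assms(2,4)]
    right_idealD(1)[OF assms(3) right_linearD(1)[OF assms(1,4)]]
  by (simp add: r_minus)

lemma right_linear_inj_on:
  assumes f: "right_linear A B f" and A: "right_ideal A R" and B: "right_ideal B R"
    and k: "\<And>x. x \<in> A \<Longrightarrow> f x = \<zero> \<Longrightarrow> x = \<zero>"
  shows "inj_on f A"
proof (rule inj_onI)
  fix x y assume xy: "x \<in> A" "y \<in> A" "f x = f y"
  have c: "x \<in> carrier R" "y \<in> carrier R" "f y \<in> carrier R"
    using xy right_idealD(1)[OF A] right_idealD(1)[OF B] right_linearD(1)[OF f] by auto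
  have "f (x \<oplus> \<ominus> y) = f x \<oplus> \<ominus> f y"
    using xy right_linear_minus[OF f A B] right_linearD(2)[OF f] right_idealD(5)[OF A] by simp
  then have "f (x \<ominus> y) = \<zero>" using xy c by (simp add: a_minus_def r_neg)
  then have "x \<ominus> y = \<zero>" using k xy right_idealD(6)[OF A] by blast
  then show "x = y" by (rule eq_if_minus_zero[OF c(1,2)])
qed

lemma right_linear_comp:
  assumes "right_linear A B f" "right_linear B C g" shows "right_linear A C (\<lambda>x. g (f x))"
  using assms by (auto simp: right_linear_def Pi_iff)

lemma right_linear_mono:
  assumes "right_linear A B f" "A' \<subseteq> A" "B \<subseteq> B'" shows "right_linear A' B' f"
  using assms by (auto simp: right_linear_def Pi_iff subset_iff)

lemma right_linear_mult:
  assumes "a \<in> carrier R" "A \<subseteq> carrier R" "\<And>x. x \<in> A \<Longrightarrow> a \<otimes> x \<in> B"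
  shows "right_linear A B ((\<otimes>) a)"
  using assms by (intro right_linearI) (auto simp: r_distr m_assoc subset_iff)

lemma right_linear_eq_mult:
  assumes "right_linear (carrier R) B f" "x \<in> carrier R" shows "f x = f \<one> \<otimes> x"
  using right_linearD(3)[OF assms(1) one_closed assms(2)] assms(2) by simp

lemma right_ideal_image:
  assumes f: "right_linear A B f" and A: "right_ideal A R" and B: "right_ideal B R"
  shows "right_ideal (f ` A) R"
proof (rule right_idealI)
  note D = right_linearD[OF f] right_idealD[OF A]
  show "\<zero> \<in> f ` A" using right_linear_zero[OF f A B] D(5) by (metis imageI)
  fix x assume x: "x \<in> f ` A"
  then obtain x' where x': "x' \<in> A" "x = f x'" by auto
  then show "x \<in> carrier R" using D right_idealD(1)[OF B] by auto
  show "x \<oplus> y \<in> f ` A" if "y \<in> f ` A" for y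
    using x' that D by (auto simp flip: D(2))
  show "x \<otimes> r \<in> f ` A" if "r \<in> carrier R" for r
    using x' that D by (auto simp flip: D(3))
qed

lemma right_ideal_kernel:
  assumes f: "right_linear A B f" and A: "right_ideal A R" and B: "right_ideal B R"
  shows "right_ideal {x \<in> A. f x = \<zero>} R"
  using right_linearD[OF f] right_idealD[OF A] right_linear_zero[OF f A B]
  by (intro right_idealI) auto

lemma right_linear_inv_into:
  assumes f: "right_linear A B f" and A: "right_ideal A R" and i: "inj_on f A"
  shows "right_linear (f ` A) A (inv_into A f)"
proof (rule right_linearI)
  note D = right_linearD[OF f] right_idealD[OF A]
  fix x assume x: "x \<in> f ` A"
  then show "inv_into A f x \<in> A" by (rule inv_into_into)
  show "inv_into A f (x \<oplus> y) = inv_into A f x \<oplus> inv_into A f y" if "y \<in> f ` A" for y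
    using x that D i by (auto simp flip: D(2))
  show "inv_into A f (x \<otimes> r) = inv_into A f x \<otimes> r" if "r \<in> carrier R" for r
    using x that D i by (auto simp flip: D(3))
qed

text \<open>
  The universal property of an internal direct sum.
\<close>

lemma right_linear_glue:
  assumes A: "right_ideal A R" and B: "right_ideal B R" and d: "A \<inter> B = {\<zero>}"
    and f: "right_linear A C f" and g: "right_linear B C g" and C: "right_ideal C R"
  obtains h where "right_linear (A <+>\<^bsub>R\<^esub> B) C h" "\<And>a b. a \<in> A \<Longrightarrow> b \<in> B \<Longrightarrow> h (a \<oplus> b) = f a \<oplus> g b"
    "\<And>a. a \<in> A \<Longrightarrow> h a = f a" "\<And>b. b \<in> B \<Longrightarrow> h b = g b"
proof -
  note a = right_idealD[OF A] and b = right_idealD[OF B] and c = right_idealD[OF C]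
    and F = right_linearD[OF f] and G = right_linearD[OF g]
  define h where "h x = (THE y. \<exists>p\<in>A. \<exists>q\<in>B. x = p \<oplus> q \<and> y = f p \<oplus> g q)" for x
  have h: "h (p \<oplus> q) = f p \<oplus> g q" if "p \<in> A" "q \<in> B" for p q
    unfolding h_def
  proof (rule the_equality)
    show "\<exists>p'\<in>A. \<exists>q'\<in>B. p \<oplus> q = p' \<oplus> q' \<and> f p \<oplus> g q = f p' \<oplus> g q'" using that by blast
    fix y assume "\<exists>p'\<in>A. \<exists>q'\<in>B. p \<oplus> q = p' \<oplus> q' \<and> y = f p' \<oplus> g q'"
    then obtain p' q' where pq: "p' \<in> A" "q' \<in> B" "p \<oplus> q = p' \<oplus> q'" "y = f p' \<oplus> g q'" by blast
    then show "y = f p \<oplus> g q" using direct_sum_cancel[OF A B d that pq(1-3)] by simp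
  qed
  have "right_linear (A <+>\<^bsub>R\<^esub> B) C h"
  proof (rule right_linearI)
    fix x assume "x \<in> A <+>\<^bsub>R\<^esub> B"
    then obtain p q where x: "p \<in> A" "q \<in> B" "x = p \<oplus> q" by (rule in_sumE)
    have xc: "p \<in> carrier R" "q \<in> carrier R" "f p \<in> carrier R" "g q \<in> carrier R"
      using x a b c F G by auto
    show "h x \<in> C" using x h F G c by simp
    show "h (x \<oplus> y) = h x \<oplus> h y" if y: "y \<in> A <+>\<^bsub>R\<^esub> B" for y
    proof -
      obtain s t where y: "s \<in> A" "t \<in> B" "y = s \<oplus> t" using y by (rule in_sumE)
      have yc: "s \<in> carrier R" "t \<in> carrier R" "f s \<in> carrier R" "g t \<in> carrier R"
        using y a b c F G by auto
      have "h (x \<oplus> y) = h ((p \<oplus> s) \<oplus> (q \<oplus> t))" using x y xc yc by (simp add: a_ac)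
      also have "\<dots> = (f p \<oplus> f s) \<oplus> (g q \<oplus> g t)" using x y h a b F G by simp
      also have "\<dots> = h x \<oplus> h y" using x y xc yc h by (simp add: a_ac)
      finally show ?thesis .
    qed
    show "h (x \<otimes> r) = h x \<otimes> r" if r: "r \<in> carrier R" for r
    proof -
      have "h (x \<otimes> r) = h (p \<otimes> r \<oplus> q \<otimes> r)" using x xc r by (simp add: l_distr)
      also have "\<dots> = f p \<otimes> r \<oplus> g q \<otimes> r" using x h a b F G r by simp
      also have "\<dots> = h x \<otimes> r" using x xc h r by (simp add: l_distr)
      finally show ?thesis .
    qed
  qed
  moreover have "h p = f p" if "p \<in> A" for p
    using h[OF that b(2)] right_linear_zero[OF g B C] a(1)[OF that] c(1)[OF F(1)[OF that]] by simp
  moreover have "h q = g q" if "q \<in> B" for q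
    using h[OF a(2) that] right_linear_zero[OF f A C] b(1)[OF that] c(1)[OF G(1)[OF that]] by simp
  ultimately show ?thesis using that h by blast
qed

lemma right_linear_const_zero: "right_ideal B R \<Longrightarrow> right_linear A B (\<lambda>x. \<zero>)"
  by (rule right_linearI) (auto simp: right_idealD)

lemma right_linear_id: "right_linear A A (\<lambda>x. x)"
  by (rule right_linearI) auto

lemma right_linear_projection:
  assumes A: "right_ideal A R" and B: "right_ideal B R" and d: "A \<inter> B = {\<zero>}"
  obtains p where "right_linear (A <+>\<^bsub>R\<^esub> B) A p" "\<And>a b. a \<in> A \<Longrightarrow> b \<in> B \<Longrightarrow> p (a \<oplus> b) = a"
    "\<And>a. a \<in> A \<Longrightarrow> p a = a" "\<And>b. b \<in> B \<Longrightarrow> p b = \<zero>"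
proof -
  obtain p where p: "right_linear (A <+>\<^bsub>R\<^esub> B) A p"
    "\<And>a b. a \<in> A \<Longrightarrow> b \<in> B \<Longrightarrow> p (a \<oplus> b) = a \<oplus> \<zero>"
    "\<And>a. a \<in> A \<Longrightarrow> p a = a" "\<And>b. b \<in> B \<Longrightarrow> p b = \<zero>"
    using right_linear_glue[OF A B d right_linear_id right_linear_const_zero[OF A] A] by blast
  moreover have "p (a \<oplus> b) = a" if "a \<in> A" "b \<in> B" for a b
    using p(2)[OF that] right_idealD(1)[OF A that(1)] by simp
  ultimately show ?thesis using that by blast
qed

lemma essential_in_iff:
  assumes I: "right_ideal I R"
  shows "essential_in N I \<longleftrightarrow> right_ideal N R \<and> N \<subseteq> I \<and>
    (\<forall>x\<in>I. x \<noteq> \<zero> \<longrightarrow> (\<exists>r\<in>carrier R. x \<otimes> r \<in> N \<and> x \<otimes> r \<noteq> \<zero>))"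
proof (intro iffI conjI ballI impI)
  assume e: "essential_in N I"
  show N: "right_ideal N R" "N \<subseteq> I" using e by (auto simp: essential_in_def)
  fix x assume x: "x \<in> I" "x \<noteq> \<zero>"
  let ?J = "(\<otimes>) x ` carrier R"
  have xc: "x \<in> carrier R" using x right_idealD[OF I] by auto
  have J: "right_ideal ?J R" by (rule right_ideal_principal[OF xc])
  have "x \<in> ?J" using xc by (auto intro!: image_eqI[of _ _ \<one>])
  then have "?J \<noteq> {\<zero>}" using x by auto
  moreover have "?J \<subseteq> I" using x right_idealD(4)[OF I] by auto
  ultimately have "?J \<inter> N \<noteq> {\<zero>}" using e J unfolding essential_in_def by blast
  then obtain y where "y \<in> ?J" "y \<in> N" "y \<noteq> \<zero>"
    using right_idealD(2)[OF J] right_idealD(2)[OF N(1)] by blast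
  then show "\<exists>r\<in>carrier R. x \<otimes> r \<in> N \<and> x \<otimes> r \<noteq> \<zero>" by auto
next
  assume e: "right_ideal N R \<and> N \<subseteq> I \<and>
    (\<forall>x\<in>I. x \<noteq> \<zero> \<longrightarrow> (\<exists>r\<in>carrier R. x \<otimes> r \<in> N \<and> x \<otimes> r \<noteq> \<zero>))"
  show "essential_in N I"
    unfolding essential_in_def
  proof (intro conjI allI impI)
    fix J assume J: "right_ideal J R \<and> J \<subseteq> I \<and> J \<inter> N = {\<zero>}"
    then have D: "\<And>x r. x \<in> J \<Longrightarrow> r \<in> carrier R \<Longrightarrow> x \<otimes> r \<in> J" "\<zero> \<in> J"
      using right_idealD[of J] by auto
    show "J = {\<zero>}"
    proof (rule ccontr)
      assume "J \<noteq> {\<zero>}"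
      then obtain x where x: "x \<in> J" "x \<noteq> \<zero>" using D by blast
      then obtain r where "r \<in> carrier R" "x \<otimes> r \<in> N" "x \<otimes> r \<noteq> \<zero>" using e J by blast
      then show False using D(1)[OF x(1)] J by blast
    qed
  qed (use e in auto)
qed

text \<open>
  Maximality of the complement \<open>C\<close> is recorded in addition to the essentiality of \<open>A + C\<close> because it
  says more: for each \<open>x\<close> outside \<open>C\<close>, it is the smaller sum \<open>C + xR\<close> that already contains a nonzero
  element of \<open>A\<close>.
\<close>

lemma complement_exists:
  assumes A: "right_ideal A R" and B: "right_ideal B R" and I: "right_ideal I R"
    and sub: "A \<subseteq> I" "B \<subseteq> I" and d: "A \<inter> B = {\<zero>}"
  obtains C where "right_ideal C R" "B \<subseteq> C" "C \<subseteq> I" "A \<inter> C = {\<zero>}" "essential_in (A <+>\<^bsub>R\<^esub> C) I"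
    "\<And>D. right_ideal D R \<Longrightarrow> C \<subseteq> D \<Longrightarrow> D \<subseteq> I \<Longrightarrow> A \<inter> D = {\<zero>} \<Longrightarrow> D = C"
proof -
  let ?good = "\<lambda>x (y::'a). x \<in> I \<and> (x \<in> A \<longrightarrow> x = \<zero>)"
  let ?ops = "\<lambda>x y. insert (x \<oplus> y) ((\<otimes>) x ` carrier R)"
  let ?P = "pairwise_closed ?good ?ops"
  have P: "?P F \<longleftrightarrow> right_ideal F R \<and> F \<subseteq> I \<and> A \<inter> F = {\<zero>}" if z: "\<zero> \<in> F" for F
  proof
    assume p: "?P F"
    have "right_ideal F R"
      by (rule right_idealI) (use p z right_idealD(1)[OF I] in \<open>auto simp: pairwise_closed_def\<close>)
    then show "right_ideal F R \<and> F \<subseteq> I \<and> A \<inter> F = {\<zero>}" 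
      using p z right_idealD(2)[OF A] unfolding pairwise_closed_def by blast
  next
    assume f: "right_ideal F R \<and> F \<subseteq> I \<and> A \<inter> F = {\<zero>}"
    then have F: "right_ideal F R" by simp
    show "?P F" unfolding pairwise_closed_def using f right_idealD(3,4)[OF F] by blast
  qed
  have "?P B" using P[OF right_idealD(2)[OF B]] B sub d by blast
  then obtain C where C: "B \<subseteq> C" "?P C" "\<And>M'. C \<subseteq> M' \<Longrightarrow> ?P M' \<Longrightarrow> M' = C"
    using maximal_pairwise_closed[of ?good ?ops B] by blast
  have zC: "\<zero> \<in> C" using C(1) right_idealD(2)[OF B] by blast
  have Cr: "right_ideal C R" "C \<subseteq> I" "A \<inter> C = {\<zero>}" using P[OF zC] C(2) by blast+
  have max: "D = C" if "right_ideal D R" "C \<subseteq> D" "D \<subseteq> I" "A \<inter> D = {\<zero>}" for D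
    using C(3)[OF that(2)] P[of D] that zC by blast
  have "essential_in (A <+>\<^bsub>R\<^esub> C) I"
    unfolding essential_in_def
  proof (intro conjI allI impI)
    show "A <+>\<^bsub>R\<^esub> C \<subseteq> I" using sum_least[OF I] sub Cr by blast
    show "right_ideal (A <+>\<^bsub>R\<^esub> C) R" by (rule right_ideal_sum[OF A Cr(1)])
    fix J assume J: "right_ideal J R \<and> J \<subseteq> I \<and> J \<inter> (A <+>\<^bsub>R\<^esub> C) = {\<zero>}"
    then have Jr: "right_ideal J R" by simp
    have "A \<inter> (C <+>\<^bsub>R\<^esub> J) = {\<zero>}"
    proof -
      have "x = \<zero>" if x: "x \<in> A" "x \<in> C <+>\<^bsub>R\<^esub> J" for x
      proof -
        obtain c j where cj: "c \<in> C" "j \<in> J" "x = c \<oplus> j" using x(2) by (rule in_sumE)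
        have k: "c \<in> carrier R" "j \<in> carrier R" using cj right_idealD(1)[OF Jr] right_idealD(1)[OF Cr(1)] by auto
        have "j = \<ominus> c \<oplus> x" using cj k by (simp add: r_neg1)
        then have "j = x \<oplus> \<ominus> c" using cj k by (simp add: a_comm)
        then have "j \<in> A <+>\<^bsub>R\<^esub> C" using x cj in_sumI right_idealD(5)[OF Cr(1)] by blast
        then have "j = \<zero>" using J cj by blast
        then have "x = c" using cj k by simp
        then show ?thesis using cj x Cr by blast
      qed
      then show ?thesis
        using right_idealD(2)[OF A] right_idealD(2)[OF right_ideal_sum[OF Cr(1) Jr]] by blast
    qed
    then have "C <+>\<^bsub>R\<^esub> J = C"
      using max[OF right_ideal_sum[OF Cr(1) Jr] sum_upper(1)[OF Cr(1) Jr]] sum_least[OF I] Cr J by blast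
    then have "J \<subseteq> C" using sum_upper(2)[OF Cr(1) Jr] by simp
    then have "J \<subseteq> A <+>\<^bsub>R\<^esub> C" using sum_upper(2)[OF A Cr(1)] by blast
    then show "J = {\<zero>}" using J by blast
  qed
  then show ?thesis using that C(1) Cr max by blast
qed

end

section \<open>Squares in rings whose automorphisms extend\<close>

text \<open>
  Summands are described by retractions, which are what relative injectivity provides.
\<close>

definition (in ring) semisimple_ideal :: "'a set \<Rightarrow> bool" where
  "semisimple_ideal A \<longleftrightarrow> (\<forall>X. right_ideal X R \<and> X \<subseteq> A \<longrightarrow>
     (\<exists>p. right_linear A X p \<and> (\<forall>x\<in>X. p x = x)))"

text \<open>
  What remains of the hypothesis on the ring once injective envelopes are eliminated.
\<close>

locale aut_extension_ring = ring +
  assumes aut_extends: "\<And>I N u. \<lbrakk>right_ideal I R; essential_in N I; right_linear N N u; bij_betw u N N\<rbrakk>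
    \<Longrightarrow> \<exists>w. right_linear I I w \<and> (\<forall>x\<in>N. w x = u x)"
begin

text \<open>
  The map \<open>a + c \<mapsto> (a + \<tau> c) + c\<close> is an automorphism of \<open>A + C\<close>, with inverse given by \<open>- \<tau>\<close>.
  Subtracting the identity from its extension leaves \<open>a + c \<mapsto> \<tau> c\<close>.
\<close>

lemma transvection_extends:
  assumes I: "right_ideal I R" and A: "right_ideal A R" and C: "right_ideal C R"
    and d: "A \<inter> C = {\<zero>}" and ess: "essential_in (A <+>\<^bsub>R\<^esub> C) I" and t: "right_linear C A \<tau>"
  obtains n where "right_linear I I n" "\<And>a. a \<in> A \<Longrightarrow> n a = \<zero>" "\<And>c. c \<in> C \<Longrightarrow> n c = \<tau> c"
proof -
  note a = right_idealD[OF A] and c = right_idealD[OF C] and i = right_idealD[OF I]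
    and T = right_linearD[OF t]
  let ?N = "A <+>\<^bsub>R\<^esub> C"
  have N: "right_ideal ?N R" by (rule right_ideal_sum[OF A C])
  have up: "\<And>x. x \<in> A \<Longrightarrow> x \<in> ?N" "\<And>x. x \<in> C \<Longrightarrow> x \<in> ?N" using sum_upper[OF A C] by auto
  have idN: "right_linear A ?N (\<lambda>x. x)" using right_linear_id up by (auto intro: right_linear_mono)
  have tc: "\<tau> x \<in> carrier R" if "x \<in> C" for x using T a that by auto
  have f1: "right_linear C ?N (\<lambda>x. \<tau> x \<oplus> x)"
  proof (rule right_linearI)
    fix x assume x: "x \<in> C"
    show "\<tau> x \<oplus> x \<in> ?N" using in_sumI[OF T(1)[OF x] x] .
    show "\<tau> (x \<oplus> y) \<oplus> (x \<oplus> y) = (\<tau> x \<oplus> x) \<oplus> (\<tau> y \<oplus> y)" if "y \<in> C" for y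
      using x that T(2) c(1) tc by (simp add: a_ac)
    show "\<tau> (x \<otimes> r) \<oplus> x \<otimes> r = (\<tau> x \<oplus> x) \<otimes> r" if "r \<in> carrier R" for r
      using x that T(3) c(1) tc by (simp add: l_distr)
  qed
  have f2: "right_linear C ?N (\<lambda>x. \<ominus> \<tau> x \<oplus> x)"
  proof (rule right_linearI)
    fix x assume x: "x \<in> C"
    show "\<ominus> \<tau> x \<oplus> x \<in> ?N" using in_sumI[OF a(5)[OF T(1)[OF x]] x] .
    show "\<ominus> \<tau> (x \<oplus> y) \<oplus> (x \<oplus> y) = (\<ominus> \<tau> x \<oplus> x) \<oplus> (\<ominus> \<tau> y \<oplus> y)" if "y \<in> C" for y
      using x that T(2) c(1) tc by (simp add: minus_add a_ac)
    show "\<ominus> \<tau> (x \<otimes> r) \<oplus> x \<otimes> r = (\<ominus> \<tau> x \<oplus> x) \<otimes> r" if "r \<in> carrier R" for r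
      using x that T(3) c(1) tc by (simp add: l_distr l_minus)
  qed
  obtain u where u: "right_linear ?N ?N u" "\<And>p q. p \<in> A \<Longrightarrow> q \<in> C \<Longrightarrow> u (p \<oplus> q) = p \<oplus> (\<tau> q \<oplus> q)"
    "\<And>p. p \<in> A \<Longrightarrow> u p = p" "\<And>q. q \<in> C \<Longrightarrow> u q = \<tau> q \<oplus> q"
    by (rule right_linear_glue[OF A C d idN f1 N]) (rule that)
  obtain v where v: "right_linear ?N ?N v" "\<And>p q. p \<in> A \<Longrightarrow> q \<in> C \<Longrightarrow> v (p \<oplus> q) = p \<oplus> (\<ominus> \<tau> q \<oplus> q)"
    by (rule right_linear_glue[OF A C d idN f2 N]) (rule that)
  have "bij_betw u ?N ?N"
  proof (rule bij_betwI[where g = v])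
    show "u \<in> ?N \<rightarrow> ?N" "v \<in> ?N \<rightarrow> ?N" using u v by (auto simp: right_linear_def)
    fix x assume "x \<in> ?N"
    then obtain p q where x: "p \<in> A" "q \<in> C" "x = p \<oplus> q" by (rule in_sumE)
    have k: "p \<in> carrier R" "q \<in> carrier R" "\<tau> q \<in> carrier R" using x a c tc by auto
    have "v (u x) = v ((p \<oplus> \<tau> q) \<oplus> q)" using x u(2) k by (simp add: a_assoc)
    also have "\<dots> = (p \<oplus> \<tau> q) \<oplus> (\<ominus> \<tau> q \<oplus> q)" using x v(2) a T by simp
    also have "\<dots> = x" using x k by (simp add: a_assoc r_neg2)
    finally show "v (u x) = x" .
    have "u (v x) = u ((p \<oplus> \<ominus> \<tau> q) \<oplus> q)" using x v(2) k by (simp add: a_assoc)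
    also have "\<dots> = (p \<oplus> \<ominus> \<tau> q) \<oplus> (\<tau> q \<oplus> q)" using x u(2) a T by simp
    also have "\<dots> = x" using x k by (simp add: a_assoc r_neg1)
    finally show "u (v x) = x" .
  qed
  then obtain w where w: "right_linear I I w" "\<And>x. x \<in> ?N \<Longrightarrow> w x = u x"
    using aut_extends[OF I ess u(1)] by blast
  note W = right_linearD[OF w(1)]
  have wc: "\<And>x. x \<in> I \<Longrightarrow> w x \<in> carrier R" using W i by auto
  have "right_linear I I (\<lambda>x. w x \<ominus> x)"
  proof (rule right_linearI)
    fix x assume x: "x \<in> I"
    show "w x \<ominus> x \<in> I" using x W i by auto
    show "w (x \<oplus> y) \<ominus> (x \<oplus> y) = (w x \<ominus> x) \<oplus> (w y \<ominus> y)" if "y \<in> I" for y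
      using x that W wc i by (simp add: a_minus_def minus_add a_ac)
    show "w (x \<otimes> r) \<ominus> x \<otimes> r = (w x \<ominus> x) \<otimes> r" if "r \<in> carrier R" for r
      using x that W wc i by (simp add: a_minus_def l_distr l_minus)
  qed
  moreover have "w p \<ominus> p = \<zero>" if "p \<in> A" for p
    using that w(2)[OF up(1)] u(3) a by (simp add: a_minus_def r_neg)
  moreover have "w q \<ominus> q = \<tau> q" if "q \<in> C" for q
    using that w(2)[OF up(2)] u(4) c tc by (simp add: a_minus_def a_assoc r_neg)
  ultimately show ?thesis using that by blast
qed

text \<open>
  Extend \<open>g\<close> by zero on a complement \<open>D\<close> of \<open>X\<close> in \<open>B\<close>.  The sum \<open>A + (X + D)\<close> is essential in
  \<open>A + B\<close>, so the extension of the transvection is defined on \<open>A + B\<close>; its \<open>A\<close>-component restricts to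
  the desired map on \<open>B\<close>.
\<close>

lemma relatively_injective:
  assumes A: "right_ideal A R" and B: "right_ideal B R" and d: "A \<inter> B = {\<zero>}"
    and X: "right_ideal X R" "X \<subseteq> B" and g: "right_linear X A g"
  obtains h where "right_linear B A h" "\<And>x. x \<in> X \<Longrightarrow> h x = g x"
proof -
  note a = right_idealD[OF A] and b = right_idealD[OF B]
  have "{\<zero>} \<subseteq> B" "X \<inter> {\<zero>} = {\<zero>}" using right_idealD(2)[OF X(1)] b by auto
  then obtain D where D: "right_ideal D R" "D \<subseteq> B" "X \<inter> D = {\<zero>}" "essential_in (X <+>\<^bsub>R\<^esub> D) B"
    by (rule complement_exists[OF X(1) right_ideal_zero B X(2)]) (rule that)
  let ?C = "X <+>\<^bsub>R\<^esub> D"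
  let ?I = "A <+>\<^bsub>R\<^esub> B"
  have C: "right_ideal ?C R" "?C \<subseteq> B"
    using right_ideal_sum[OF X(1) D(1)] sum_least[OF B X(2) D(2)] by auto
  have I: "right_ideal ?I R" by (rule right_ideal_sum[OF A B])
  have dC: "A \<inter> ?C = {\<zero>}" using d C a right_idealD(2)[OF C(1)] by blast
  obtain \<tau> where t: "right_linear ?C A \<tau>" "\<And>x. x \<in> X \<Longrightarrow> \<tau> x = g x"
    by (rule right_linear_glue[OF X(1) D(1) D(3) g right_linear_const_zero[OF A] A]) (rule that)
  have "essential_in (A <+>\<^bsub>R\<^esub> ?C) ?I"
    unfolding essential_in_iff[OF I]
  proof (intro conjI ballI impI)
    show AC: "right_ideal (A <+>\<^bsub>R\<^esub> ?C) R" by (rule right_ideal_sum[OF A C(1)])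
    show "A <+>\<^bsub>R\<^esub> ?C \<subseteq> ?I" using sum_least[OF I] sum_upper[OF A B] C(2) by blast
    fix x assume "x \<in> ?I" "x \<noteq> \<zero>"
    then obtain p q where x: "p \<in> A" "q \<in> B" "x = p \<oplus> q" using in_sumE by metis
    have k: "p \<in> carrier R" "q \<in> carrier R" using x a b by auto
    show "\<exists>r\<in>carrier R. x \<otimes> r \<in> A <+>\<^bsub>R\<^esub> ?C \<and> x \<otimes> r \<noteq> \<zero>"
    proof (cases "q = \<zero>")
      case True
      then have "x \<in> A <+>\<^bsub>R\<^esub> ?C" using x k sum_upper[OF A C(1)] by auto
      then show ?thesis using \<open>x \<noteq> \<zero>\<close> x k by (intro bexI[of _ \<one>]) auto
    next
      case False
      then obtain r where r: "r \<in> carrier R" "q \<otimes> r \<in> ?C" "q \<otimes> r \<noteq> \<zero>"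
        using D(4) x(2) unfolding essential_in_iff[OF B] by blast
      have e: "x \<otimes> r = p \<otimes> r \<oplus> q \<otimes> r" using x k r by (simp add: l_distr)
      have "x \<otimes> r \<noteq> \<zero>"
      proof
        assume "x \<otimes> r = \<zero>"
        then have "p \<otimes> r \<oplus> q \<otimes> r = \<zero> \<oplus> \<zero>" using e by simp
        then have "q \<otimes> r = \<zero>"
          using direct_sum_cancel[OF A B d a(4)[OF x(1) r(1)] b(4)[OF x(2) r(1)] a(2) b(2)] by simp
        then show False using r by simp
      qed
      then show ?thesis
        using e r(1) in_sumI[OF a(4)[OF x(1) r(1)] r(2)] by (intro bexI[of _ r]) auto
    qed
  qed
  then obtain n where n: "right_linear ?I ?I n" "\<And>c. c \<in> ?C \<Longrightarrow> n c = \<tau> c"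
    using transvection_extends[OF I A C(1) dC _ t(1)] by blast
  obtain p where p: "right_linear ?I A p" "\<And>a. a \<in> A \<Longrightarrow> p a = a"
    by (rule right_linear_projection[OF A B d]) (rule that)
  have "right_linear B A (\<lambda>x. p (n x))"
    using right_linear_mono[OF right_linear_comp[OF n(1) p(1)] sum_upper(2)[OF A B]] by blast
  moreover have "p (n x) = g x" if "x \<in> X" for x
    using n(2) sum_upper(1)[OF X(1) D(1)] that t(2) p(2) right_linearD(1)[OF g] by auto
  ultimately show ?thesis using that by blast
qed

text \<open>
  A right ideal \<open>X \<subseteq> A\<close> is injective relative to \<open>\<sigma> ` A\<close>, since the two have intersection zero, and
  therefore relative to the isomorphic \<open>A\<close>.  Extending the identity of \<open>X\<close> to \<open>A\<close> gives a retraction.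
\<close>

lemma square_semisimple:
  assumes A: "right_ideal A R" and s: "right_linear A (carrier R) \<sigma>" and i: "inj_on \<sigma> A"
    and d: "A \<inter> \<sigma> ` A = {\<zero>}"
  shows "semisimple_ideal A"
  unfolding semisimple_ideal_def
proof (intro allI impI)
  fix X assume "right_ideal X R \<and> X \<subseteq> A"
  then have X: "right_ideal X R" "X \<subseteq> A" by auto
  have B: "right_ideal (\<sigma> ` A) R" by (rule right_ideal_image[OF s A right_ideal_carrier])
  have sX: "right_linear X (carrier R) \<sigma>" "inj_on \<sigma> X"
    using right_linear_mono[OF s X(2)] inj_on_subset[OF i X(2)] by auto
  have Y: "right_ideal (\<sigma> ` X) R" by (rule right_ideal_image[OF sX(1) X(1) right_ideal_carrier])
  have "X \<inter> \<sigma> ` A = {\<zero>}" using X d right_idealD(2)[OF X(1)] by blast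
  then obtain h where h: "right_linear (\<sigma> ` A) X h" "\<And>x. x \<in> \<sigma> ` X \<Longrightarrow> h x = inv_into X \<sigma> x"
    using relatively_injective[OF X(1) B _ Y _ right_linear_inv_into[OF sX(1) X(1) sX(2)]] X(2)
    by (metis image_mono)
  have "right_linear A (\<sigma> ` A) \<sigma>" using s by (auto simp: right_linear_def)
  then have "right_linear A X (\<lambda>x. h (\<sigma> x))" using h(1) by (rule right_linear_comp)
  moreover have "h (\<sigma> x) = x" if "x \<in> X" for x using h(2) that sX(2) by simp
  ultimately show "\<exists>p. right_linear A X p \<and> (\<forall>x\<in>X. p x = x)" by blast
qed

text \<open>
  Let \<open>C\<close> be a complement of \<open>A\<close> that contains \<open>B\<close>, and let \<open>\<tau>\<close> be an extension of the inverse of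
  \<open>\<sigma>\<close> to \<open>C\<close>.  The extensions \<open>n\<close> and \<open>m\<close> of \<open>a + c \<mapsto> \<tau> c\<close> and \<open>a + c \<mapsto> \<sigma> a\<close> to the whole ring
  compose to an extension \<open>q\<close> of the projection of \<open>A + C\<close> onto \<open>A\<close>.  The image of \<open>q\<close> may be larger
  than \<open>A\<close>, but it meets \<open>C\<close> in zero.  Hence \<open>\<sigma>\<close> extends from \<open>A\<close> to the image of \<open>q\<close> with values in
  \<open>\<sigma> ` A\<close>, and following \<open>q\<close> by this extension and by \<open>\<tau>\<close> gives a retraction of the ring onto \<open>A\<close>
  that kills \<open>C\<close>.  It is the left multiplication by its value at \<open>1\<close>.
\<close>

lemma square_summand:
  assumes A: "right_ideal A R" and B: "right_ideal B R" and d: "A \<inter> B = {\<zero>}"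
    and s: "right_linear A B \<sigma>" and i: "inj_on \<sigma> A"
  obtains e where "e \<in> A" "\<And>a. a \<in> A \<Longrightarrow> e \<otimes> a = a" "\<And>b. b \<in> B \<Longrightarrow> e \<otimes> b = \<zero>"
proof -
  note a = right_idealD[OF A]
  note U = right_ideal_carrier
  have "A \<subseteq> carrier R" "B \<subseteq> carrier R" using right_idealD(1)[OF A] right_idealD(1)[OF B] by auto
  then obtain C where C: "right_ideal C R" "B \<subseteq> C" "A \<inter> C = {\<zero>}" "essential_in (A <+>\<^bsub>R\<^esub> C) (carrier R)"
    and max: "\<And>D. right_ideal D R \<Longrightarrow> C \<subseteq> D \<Longrightarrow> D \<subseteq> carrier R \<Longrightarrow> A \<inter> D = {\<zero>} \<Longrightarrow> D = C"
    by (rule complement_exists[OF A B U _ _ d]) (rule that)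
  note c = right_idealD[OF C(1)]
  let ?A' = "\<sigma> ` A"
  have A': "right_ideal ?A' R" "?A' \<subseteq> C" "?A' \<subseteq> B"
    using right_ideal_image[OF s A B] right_linearD(1)[OF s] C(2) by auto
  obtain \<tau> where t: "right_linear C A \<tau>" "\<And>x. x \<in> ?A' \<Longrightarrow> \<tau> x = inv_into A \<sigma> x"
    using relatively_injective[OF A C(1) C(3) A'(1,2) right_linear_inv_into[OF s A i]] by blast
  have ts: "\<tau> (\<sigma> x) = x" if "x \<in> A" for x using t(2) i that by simp
  obtain n where n: "right_linear (carrier R) (carrier R) n" "\<And>c. c \<in> C \<Longrightarrow> n c = \<tau> c"
    using transvection_extends[OF U A C(1) C(3,4) t(1)] by blast
  have CA: "C \<inter> A = {\<zero>}" "C <+>\<^bsub>R\<^esub> A = A <+>\<^bsub>R\<^esub> C"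
    using C(3) a(1) c(1) by (auto simp: set_add_def') (metis a_comm)+
  have "right_linear A C \<sigma>" using s C(2) by (auto intro: right_linear_mono)
  then obtain m where m: "right_linear (carrier R) (carrier R) m"
    "\<And>c. c \<in> C \<Longrightarrow> m c = \<zero>" "\<And>a. a \<in> A \<Longrightarrow> m a = \<sigma> a"
    using transvection_extends[OF U C(1) A CA(1)] C(4) CA(2) by metis
  define q where "q x = n (m x)" for x
  have q: "right_linear (carrier R) (carrier R) q"
    unfolding q_def by (rule right_linear_comp[OF m(1) n(1)])
  have qa: "q x = x" if "x \<in> A" for x using that m(3) n(2) A'(2) ts unfolding q_def by auto
  have nz: "n \<zero> = \<zero>" by (rule right_linear_zero[OF n(1) U U])
  have qc: "q x = \<zero>" if "x \<in> C" for x using that m(2) nz unfolding q_def by auto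
  let ?Q = "q ` carrier R"
  have Q: "right_ideal ?Q R" by (rule right_ideal_image[OF q U U])
  have AQ: "A \<subseteq> ?Q" using qa a(1) by (metis image_eqI subsetI)
  have dQ: "?A' \<inter> ?Q = {\<zero>}"
  proof -
    \<comment> \<open>If \<open>y = q r\<close> is nonzero, then \<open>r\<close> is outside \<open>C\<close>, and \<open>C + rR\<close> has a nonzero element in \<open>A\<close> by maximality;
      applying \<open>q\<close> to that element puts it into both \<open>A\<close> and \<open>yR \<subseteq> C\<close>.\<close>
    have "y = \<zero>" if y: "y \<in> C" "y \<in> ?Q" for y
    proof (rule ccontr)
      assume y0: "y \<noteq> \<zero>"
      obtain r where r: "r \<in> carrier R" "y = q r" using y by auto
      let ?P = "(\<otimes>) r ` carrier R"
      have P: "right_ideal ?P R" by (rule right_ideal_principal[OF r(1)])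
      have CP: "right_ideal (C <+>\<^bsub>R\<^esub> ?P) R" by (rule right_ideal_sum[OF C(1) P])
      have rP: "r \<in> C <+>\<^bsub>R\<^esub> ?P"
        using sum_upper(2)[OF C(1) P] r by (auto intro!: image_eqI[of _ _ \<one>] simp: subset_iff)
      have "r \<notin> C" using qc r y0 by auto
      then have "A \<inter> (C <+>\<^bsub>R\<^esub> ?P) \<noteq> {\<zero>}"
        using max[OF CP sum_upper(1)[OF C(1) P]] rP right_idealD(1)[OF CP] by blast
      then obtain x where x: "x \<in> A" "x \<in> C <+>\<^bsub>R\<^esub> ?P" "x \<noteq> \<zero>"
        using a(2) right_idealD(2)[OF CP] by blast
      then obtain z t where zt: "z \<in> C" "t \<in> carrier R" "x = z \<oplus> r \<otimes> t"
        by (auto elim!: in_sumE)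
      have "x = q x" using qa x by simp
      also have "\<dots> = q z \<oplus> q (r \<otimes> t)" using zt r right_linearD(2)[OF q] c(1) by simp
      also have "\<dots> = y \<otimes> t"
        using zt r right_linearD[OF q] qc c(1) by simp
      finally have "x \<in> C" using c(4)[OF y(1)] zt by simp
      then show False using x C(3) by blast
    qed
    then show ?thesis using A' right_idealD(2)[OF A'(1)] right_idealD(2)[OF Q] by blast
  qed
  have "right_linear A ?A' \<sigma>" using s by (auto simp: right_linear_def)
  then obtain v where v: "right_linear ?Q ?A' v" "\<And>x. x \<in> A \<Longrightarrow> v x = \<sigma> x"
    using relatively_injective[OF A'(1) Q dQ A AQ] by blast
  have vz: "v \<zero> = \<zero>" by (rule right_linear_zero[OF v(1) Q A'(1)])
  have tz: "\<tau> \<zero> = \<zero>" by (rule right_linear_zero[OF t(1) C(1) A])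
  have "right_linear (carrier R) ?Q q" using q by (auto simp: right_linear_def)
  then have "right_linear (carrier R) A (\<lambda>x. \<tau> (v (q x)))"
    using right_linear_comp[OF right_linear_comp[OF _ v(1)] right_linear_mono[OF t(1) A'(2) subset_refl]]
    by blast
  note p = right_linear_eq_mult[OF this] right_linearD(1)[OF this one_closed]
  show ?thesis
  proof (rule that[OF p(2)])
    show "\<tau> (v (q \<one>)) \<otimes> x = x" if "x \<in> A" for x
      using p(1)[of x] a(1) that qa v(2) ts by simp
    show "\<tau> (v (q \<one>)) \<otimes> x = \<zero>" if "x \<in> B" for x
      using p(1)[of x] c(1) that C(2) qc vz tz by (simp add: subset_iff)
  qed
qed

end

section \<open>A maximal square\<close>

context ring
begin

lemma linear_of_graph:
  assumes F: "(\<zero>, \<zero>) \<in> F" "\<And>x y. (x, y) \<in> F \<Longrightarrow> x \<in> carrier R \<and> y \<in> carrier R \<and> (x = \<zero> \<longleftrightarrow> y = \<zero>)"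
    and add: "\<And>x y z w. (x, y) \<in> F \<Longrightarrow> (z, w) \<in> F \<Longrightarrow> (x \<oplus> z, y \<oplus> w) \<in> F"
    and mult: "\<And>x y r. (x, y) \<in> F \<Longrightarrow> r \<in> carrier R \<Longrightarrow> (x \<otimes> r, y \<otimes> r) \<in> F"
  obtains A \<sigma> where "right_ideal A R" "right_linear A (carrier R) \<sigma>" "inj_on \<sigma> A"
    "F = (\<lambda>x. (x, \<sigma> x)) ` A"
proof -
  have uniq: "y = y'" if "(x, y) \<in> F" "(x, y') \<in> F" for x y y'
  proof -
    have k: "x \<in> carrier R" "y \<in> carrier R" "y' \<in> carrier R" using F(2) that by blast+
    have "(x \<oplus> x \<otimes> (\<ominus> \<one>), y \<oplus> y' \<otimes> (\<ominus> \<one>)) \<in> F" using add mult that by blast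
    then have "(\<zero>, y \<ominus> y') \<in> F" using k by (simp add: r_minus r_neg a_minus_def)
    then have "y \<ominus> y' = \<zero>" using F(2) by blast
    then show ?thesis using eq_if_minus_zero k by blast
  qed
  define \<sigma> where "\<sigma> x = (THE y. (x, y) \<in> F)" for x
  have s: "\<sigma> x = y" if "(x, y) \<in> F" for x y
    unfolding \<sigma>_def using that uniq by blast
  let ?A = "fst ` F"
  have sF: "(x, \<sigma> x) \<in> F" if "x \<in> ?A" for x using that s by force
  have AI: "x \<in> ?A" if "(x, y) \<in> F" for x y using that by force
  have A: "right_ideal ?A R"
  proof (rule right_idealI)
    show "\<zero> \<in> ?A" using F(1) AI by blast
    fix x assume x: "x \<in> ?A"
    then show "x \<in> carrier R" using F(2) sF by blast
    show "x \<oplus> y \<in> ?A" if "y \<in> ?A" for y using add sF x that AI by blast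
    show "x \<otimes> r \<in> ?A" if "r \<in> carrier R" for r using mult sF x that AI by blast
  qed
  have lin: "right_linear ?A (carrier R) \<sigma>"
  proof (rule right_linearI)
    fix x assume x: "x \<in> ?A"
    then show "\<sigma> x \<in> carrier R" using F(2) sF by blast
    show "\<sigma> (x \<oplus> y) = \<sigma> x \<oplus> \<sigma> y" if "y \<in> ?A" for y using s add sF x that by blast
    show "\<sigma> (x \<otimes> r) = \<sigma> x \<otimes> r" if "r \<in> carrier R" for r using s mult sF x that by blast
  qed
  have inj: "inj_on \<sigma> ?A"
    by (rule right_linear_inj_on[OF lin A right_ideal_carrier]) (use F(2) sF in metis)
  have "F = (\<lambda>x. (x, \<sigma> x)) ` ?A"
  proof (intro equalityI subsetI)
    fix p assume p: "p \<in> F"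
    obtain x y where xy: "p = (x, y)" by (cases p)
    then have "\<sigma> x = y" "x \<in> ?A" using p s AI by blast+
    then show "p \<in> (\<lambda>x. (x, \<sigma> x)) ` ?A" using xy by blast
  qed (use sF in blast)
  then show ?thesis using that A lin inj by blast
qed

text \<open>
  Zorn's lemma for injective linear maps whose graph satisfies a binary relation \<open>Q\<close>.  Maximality is
  expressed by what an attempt at enlargement looks like: the map \<open>x + \<alpha> w \<mapsto> \<sigma> x + \<beta> w\<close> on
  \<open>A + \<alpha> ` W\<close>.  The equivalence in its premise says that this is well defined and injective.
\<close>

lemma maximal_injective_linear:
  fixes Q :: "'a \<Rightarrow> 'a \<Rightarrow> 'a \<Rightarrow> 'a \<Rightarrow> bool"
  assumes Q0: "Q \<zero> \<zero> \<zero> \<zero>"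
  obtains A \<sigma> where "right_ideal A R" "right_linear A (carrier R) \<sigma>" "inj_on \<sigma> A"
    "\<And>x y. x \<in> A \<Longrightarrow> y \<in> A \<Longrightarrow> Q x (\<sigma> x) y (\<sigma> y)"
    "\<And>W \<alpha> \<beta> w. \<lbrakk>right_ideal W R; right_linear W (carrier R) \<alpha>; right_linear W (carrier R) \<beta>;
       \<And>x w. x \<in> A \<Longrightarrow> w \<in> W \<Longrightarrow> x \<oplus> \<alpha> w = \<zero> \<longleftrightarrow> \<sigma> x \<oplus> \<beta> w = \<zero>;
       \<And>x w y v. x \<in> A \<Longrightarrow> w \<in> W \<Longrightarrow> y \<in> A \<Longrightarrow> v \<in> W \<Longrightarrow>
         Q (x \<oplus> \<alpha> w) (\<sigma> x \<oplus> \<beta> w) (y \<oplus> \<alpha> v) (\<sigma> y \<oplus> \<beta> v);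
       w \<in> W\<rbrakk> \<Longrightarrow> \<alpha> w \<in> A"
proof -
  define good where "good p q \<longleftrightarrow> fst p \<in> carrier R \<and> snd p \<in> carrier R \<and> (fst p = \<zero> \<longleftrightarrow> snd p = \<zero>) \<and>
    Q (fst p) (snd p) (fst q) (snd q)" for p q
  define ops where "ops p q = insert (fst p \<oplus> fst q, snd p \<oplus> snd q)
    ((\<lambda>r. (fst p \<otimes> r, snd p \<otimes> r)) ` carrier R)" for p q :: "'a \<times> 'a"
  have "pairwise_closed good ops {(\<zero>, \<zero>)}"
    using Q0 by (auto simp: pairwise_closed_def good_def ops_def)
  from maximal_pairwise_closed[OF this]
  obtain F where F0: "(\<zero>, \<zero>) \<in> F" and F: "pairwise_closed good ops F"
    and max: "\<And>F'. F \<subseteq> F' \<Longrightarrow> pairwise_closed good ops F' \<Longrightarrow> F' = F"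
    by auto
  have g: "good p q" "ops p q \<subseteq> F" if "p \<in> F" "q \<in> F" for p q
    using F that unfolding pairwise_closed_def by blast+
  have carr: "x \<in> carrier R \<and> y \<in> carrier R \<and> (x = \<zero> \<longleftrightarrow> y = \<zero>)" if "(x, y) \<in> F" for x y
    using g(1)[OF that that] by (auto simp: good_def)
  have add: "(x \<oplus> z, y \<oplus> w) \<in> F" if "(x, y) \<in> F" "(z, w) \<in> F" for x y z w
    using g(2)[OF that] by (auto simp: ops_def)
  have mult: "(x \<otimes> r, y \<otimes> r) \<in> F" if "(x, y) \<in> F" "r \<in> carrier R" for x y r
    using g(2)[OF that(1) that(1)] that(2) by (auto simp: ops_def)
  obtain A \<sigma> where A: "right_ideal A R" and s: "right_linear A (carrier R) \<sigma>" and i: "inj_on \<sigma> A"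
    and FA: "F = (\<lambda>x. (x, \<sigma> x)) ` A"
    by (rule linear_of_graph[OF F0 carr add mult]) (assumption | rule that)+
  note a = right_idealD[OF A] and S = right_linearD[OF s]
  have Q: "Q x (\<sigma> x) y (\<sigma> y)" if "x \<in> A" "y \<in> A" for x y
    using g(1)[of "(x, \<sigma> x)" "(y, \<sigma> y)"] that FA by (auto simp: good_def)
  have maximal: "\<alpha> w \<in> A" if W: "right_ideal W R" and al: "right_linear W (carrier R) \<alpha>"
    and be: "right_linear W (carrier R) \<beta>"
    and z: "\<And>x w. x \<in> A \<Longrightarrow> w \<in> W \<Longrightarrow> x \<oplus> \<alpha> w = \<zero> \<longleftrightarrow> \<sigma> x \<oplus> \<beta> w = \<zero>"
    and QW: "\<And>x w y v. x \<in> A \<Longrightarrow> w \<in> W \<Longrightarrow> y \<in> A \<Longrightarrow> v \<in> W \<Longrightarrow>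
         Q (x \<oplus> \<alpha> w) (\<sigma> x \<oplus> \<beta> w) (y \<oplus> \<alpha> v) (\<sigma> y \<oplus> \<beta> v)"
    and w: "w \<in> W" for W \<alpha> \<beta> w
  proof -
    note W' = right_idealD[OF W] and L = right_linearD[OF al] and B = right_linearD[OF be]
    let ?G = "\<lambda>x w. (x \<oplus> \<alpha> w, \<sigma> x \<oplus> \<beta> w)"
    let ?F = "{?G x w | x w. x \<in> A \<and> w \<in> W}"
    have z0: "\<alpha> \<zero> = \<zero>" "\<beta> \<zero> = \<zero>" "\<sigma> \<zero> = \<zero>"
      using right_linear_zero[OF al W right_ideal_carrier] right_linear_zero[OF be W right_ideal_carrier]
        right_linear_zero[OF s A right_ideal_carrier] by auto
    have "F \<subseteq> ?F"
    proof
      fix p assume "p \<in> F"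
      then obtain x where x: "x \<in> A" "p = (x, \<sigma> x)" using FA by auto
      then have "p = ?G x \<zero>" using z0 a S by simp
      then show "p \<in> ?F" using x W'(2) by blast
    qed
    moreover have "pairwise_closed good ops ?F"
      unfolding pairwise_closed_def
    proof (intro ballI)
      fix p q assume "p \<in> ?F" "q \<in> ?F"
      then obtain x u y v where pq: "x \<in> A" "u \<in> W" "y \<in> A" "v \<in> W" "p = ?G x u" "q = ?G y v" by blast
      have k: "x \<in> carrier R" "y \<in> carrier R" "\<alpha> u \<in> carrier R" "\<alpha> v \<in> carrier R"
        "\<beta> u \<in> carrier R" "\<beta> v \<in> carrier R" "\<sigma> x \<in> carrier R" "\<sigma> y \<in> carrier R"
        using pq a(1) L(1) B(1) S(1) by auto
      have "good p q" using pq k z QW by (auto simp: good_def)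
      moreover have "(fst p \<oplus> fst q, snd p \<oplus> snd q) = ?G (x \<oplus> y) (u \<oplus> v)"
        using pq(1-4) k by (simp add: pq(5,6) L(2) B(2) S(2) a_ac)
      then have "(fst p \<oplus> fst q, snd p \<oplus> snd q) \<in> ?F" using a(3)[OF pq(1,3)] W'(3)[OF pq(2,4)] by blast
      moreover have "(fst p \<otimes> r, snd p \<otimes> r) \<in> ?F" if r: "r \<in> carrier R" for r
      proof -
        have "(fst p \<otimes> r, snd p \<otimes> r) = ?G (x \<otimes> r) (u \<otimes> r)"
          using pq(1-4) k r by (simp add: pq(5) L(3) B(3) S(3) l_distr)
        then show ?thesis using a(4)[OF pq(1) r] W'(4)[OF pq(2) r] by blast
      qed
      ultimately show "good p q \<and> ops p q \<subseteq> ?F" by (auto simp: ops_def simp del: mem_Collect_eq)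
    qed
    ultimately have e: "?F = F" by (rule max)
    have "?G \<zero> w \<in> ?F" using a(2) w by blast
    then have "?G \<zero> w \<in> F" using e by simp
    then show ?thesis using FA L(1)[OF w] by auto
  qed
  show ?thesis
  proof (rule that[OF A s i])
    show "Q x (\<sigma> x) y (\<sigma> y)" if "x \<in> A" "y \<in> A" for x y using Q that .
  qed (fact maximal)
qed

end

text \<open>
  A maximal pair of isomorphic right ideals \<open>A = eR\<close> and \<open>A' = e'R\<close> with zero intersection.  What
  maximality means for the sequel is the last assumption: the common right annihilator of \<open>e\<close> and
  \<open>e'\<close>, which is \<open>(1 - e - e')R\<close>, contains no two independent isomorphic right ideals other than
  zero.
\<close>

locale maximal_square = aut_extension_ring +
  fixes A A' \<sigma> e e'
  assumes A: "right_ideal A R" and A': "right_ideal A' R"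
    and lin: "right_linear A A' \<sigma>" and inj: "inj_on \<sigma> A" and img: "\<sigma> ` A = A'"
    and e_in: "e \<in> A" and e'_in: "e' \<in> A'"
    and eA: "\<And>a. a \<in> A \<Longrightarrow> e \<otimes> a = a" and eA': "\<And>a. a \<in> A' \<Longrightarrow> e \<otimes> a = \<zero>"
    and e'A': "\<And>a. a \<in> A' \<Longrightarrow> e' \<otimes> a = a" and e'A: "\<And>a. a \<in> A \<Longrightarrow> e' \<otimes> a = \<zero>"
    and square_free: "\<And>W \<alpha> \<beta>. \<lbrakk>right_ideal W R; right_linear W (carrier R) \<alpha>; inj_on \<alpha> W;
       right_linear W (carrier R) \<beta>; inj_on \<beta> W; \<alpha> ` W \<inter> \<beta> ` W = {\<zero>};
       \<And>w. w \<in> W \<Longrightarrow> e \<otimes> \<alpha> w = \<zero> \<and> e' \<otimes> \<alpha> w = \<zero> \<and> e \<otimes> \<beta> w = \<zero> \<and> e' \<otimes> \<beta> w = \<zero>\<rbrakk>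
       \<Longrightarrow> W = {\<zero>}"

text \<open>
  The relation imposed on the graph of \<open>\<sigma>\<close> says that an element of both the domain and the range is
  zero.  A square \<open>\<alpha> ` W \<cong> \<beta> ` W\<close> annihilated by \<open>e\<close> and \<open>e'\<close> could be added to a maximal such
  \<open>\<sigma>\<close>: multiplication by \<open>e\<close> and \<open>e'\<close> separates the old components from the new ones.
\<close>

lemma (in aut_extension_ring) maximal_square_exists:
  obtains A A' \<sigma> e e' where "maximal_square R A A' \<sigma> e e'"
proof (rule maximal_injective_linear[of "\<lambda>x y z w. y = z \<longrightarrow> z = \<zero>"])
  fix A \<sigma>
  assume A: "right_ideal A R" and s: "right_linear A (carrier R) \<sigma>" and i: "inj_on \<sigma> A"
    and Q: "\<And>x y. x \<in> A \<Longrightarrow> y \<in> A \<Longrightarrow> \<sigma> x = y \<longrightarrow> y = \<zero>"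
    and max: "\<And>W \<alpha> \<beta> w. \<lbrakk>right_ideal W R; right_linear W (carrier R) \<alpha>; right_linear W (carrier R) \<beta>;
       \<And>x w. x \<in> A \<Longrightarrow> w \<in> W \<Longrightarrow> x \<oplus> \<alpha> w = \<zero> \<longleftrightarrow> \<sigma> x \<oplus> \<beta> w = \<zero>;
       \<And>x w y v. x \<in> A \<Longrightarrow> w \<in> W \<Longrightarrow> y \<in> A \<Longrightarrow> v \<in> W \<Longrightarrow>
         \<sigma> x \<oplus> \<beta> w = y \<oplus> \<alpha> v \<longrightarrow> y \<oplus> \<alpha> v = \<zero>;
       w \<in> W\<rbrakk> \<Longrightarrow> \<alpha> w \<in> A"
  let ?A' = "\<sigma> ` A"
  note a = right_idealD[OF A] and S = right_linearD[OF s]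
  have A': "right_ideal ?A' R" by (rule right_ideal_image[OF s A right_ideal_carrier])
  note a' = right_idealD[OF A']
  have lin: "right_linear A ?A' \<sigma>" using s by (auto simp: right_linear_def)
  have d: "A \<inter> ?A' = {\<zero>}" using Q a(2) a'(2) by blast
  have d': "?A' \<inter> A = {\<zero>}" using d by blast
  obtain e where e: "e \<in> A" "\<And>a. a \<in> A \<Longrightarrow> e \<otimes> a = a" "\<And>b. b \<in> ?A' \<Longrightarrow> e \<otimes> b = \<zero>"
    by (rule square_summand[OF A A' d lin i]) (rule that)
  have "inj_on (inv_into A \<sigma>) ?A'" by (rule inj_on_inv_into) simp
  from square_summand[OF A' A d' right_linear_inv_into[OF s A i] this]
  obtain e' where e': "e' \<in> ?A'" "\<And>a. a \<in> ?A' \<Longrightarrow> e' \<otimes> a = a" "\<And>b. b \<in> A \<Longrightarrow> e' \<otimes> b = \<zero>"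
    by metis
  have ec: "e \<in> carrier R" "e' \<in> carrier R" using e e' a a' by auto
  have "W = {\<zero>}" if W: "right_ideal W R" and al: "right_linear W (carrier R) \<alpha>" "inj_on \<alpha> W"
    and be: "right_linear W (carrier R) \<beta>" "inj_on \<beta> W" and dis: "\<alpha> ` W \<inter> \<beta> ` W = {\<zero>}"
    and K: "\<And>w. w \<in> W \<Longrightarrow> e \<otimes> \<alpha> w = \<zero> \<and> e' \<otimes> \<alpha> w = \<zero> \<and> e \<otimes> \<beta> w = \<zero> \<and> e' \<otimes> \<beta> w = \<zero>"
    for W \<alpha> \<beta>
  proof -
    note w = right_idealD[OF W] and L = right_linearD[OF al(1)] and B = right_linearD[OF be(1)]
    have z: "\<alpha> \<zero> = \<zero>" "\<beta> \<zero> = \<zero>" "\<sigma> \<zero> = \<zero>"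
      using right_linear_zero[OF al(1) W right_ideal_carrier] right_linear_zero[OF be(1) W right_ideal_carrier]
        right_linear_zero[OF s A right_ideal_carrier] by auto
    have az: "x = \<zero>" if "x \<in> W" "\<alpha> x = \<zero>" for x using al(2) that w(2) z by (metis inj_onD)
    have bz: "x = \<zero>" if "x \<in> W" "\<beta> x = \<zero>" for x using be(2) that w(2) z by (metis inj_onD)
    have sz: "x = \<zero>" if "x \<in> A" "\<sigma> x = \<zero>" for x using i that a(2) z by (metis inj_onD)
    have c1: "e \<otimes> (x \<oplus> \<alpha> u) = x" "e' \<otimes> (x \<oplus> \<alpha> u) = \<zero>"
      "e \<otimes> (\<sigma> x \<oplus> \<beta> u) = \<zero>" "e' \<otimes> (\<sigma> x \<oplus> \<beta> u) = \<sigma> x"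
      if "x \<in> A" "u \<in> W" for x u
      using that K[of u] e e' ec a(1) S(1) L(1) B(1) by (simp_all add: r_distr)
    have "\<alpha> u \<in> A" if u: "u \<in> W" for u
    proof (rule max[OF W al(1) be(1) _ _ u])
      fix x v assume x: "x \<in> A" and v: "v \<in> W"
      have k: "x \<in> carrier R" "\<sigma> x \<in> carrier R" "\<alpha> v \<in> carrier R" "\<beta> v \<in> carrier R"
        using x v a S L B by auto
      show "x \<oplus> \<alpha> v = \<zero> \<longleftrightarrow> \<sigma> x \<oplus> \<beta> v = \<zero>"
      proof
        assume h: "x \<oplus> \<alpha> v = \<zero>"
        then have x0: "x = \<zero>" using c1(1)[OF x v] ec by simp
        then have "v = \<zero>" using h k az v by simp
        then show "\<sigma> x \<oplus> \<beta> v = \<zero>" using x0 z by simp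
      next
        assume h: "\<sigma> x \<oplus> \<beta> v = \<zero>"
        then have x0: "\<sigma> x = \<zero>" using c1(4)[OF x v] ec by simp
        then have "v = \<zero>" using h k bz v by simp
        then show "x \<oplus> \<alpha> v = \<zero>" using sz[OF x x0] z by simp
      qed
      fix y t assume y: "y \<in> A" and t: "t \<in> W"
      have k': "y \<in> carrier R" "\<alpha> t \<in> carrier R" using y t a L by auto
      show "\<sigma> x \<oplus> \<beta> v = y \<oplus> \<alpha> t \<longrightarrow> y \<oplus> \<alpha> t = \<zero>"
      proof
        assume h: "\<sigma> x \<oplus> \<beta> v = y \<oplus> \<alpha> t"
        have y0: "y = \<zero>" using c1(1)[OF y t] c1(3)[OF x v] h by simp
        have "\<sigma> x = \<zero>" using c1(2)[OF y t] c1(4)[OF x v] h by simp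
        then have "\<beta> v = \<alpha> t" using h y0 k k' by simp
        then have "\<alpha> t \<in> \<alpha> ` W \<inter> \<beta> ` W" using v t by force
        then have "\<alpha> t = \<zero>" using dis by blast
        then show "y \<oplus> \<alpha> t = \<zero>" using y0 by simp
      qed
    qed
    then have "u = \<zero>" if "u \<in> W" for u using that az K e(2) by metis
    then show ?thesis using w(2) by blast
  qed
  then have "maximal_square R A ?A' \<sigma> e e'"
    by unfold_locales (use A A' lin i e e' in auto)
  then show thesis by (rule that)
qed simp

section \<open>The central idempotent\<close>

context ring
begin

lemma semisimple_retract:
  assumes "semisimple_ideal A" "right_ideal X R" "X \<subseteq> A"
  obtains p where "right_linear A X p" "\<And>x. x \<in> X \<Longrightarrow> p x = x"
  using assms unfolding semisimple_ideal_def by blast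

text \<open>
  A complement of \<open>B \<inter> N\<close> in \<open>B\<close> meets \<open>N\<close> in zero, so it is zero.
\<close>

lemma semisimple_subset_essential:
  assumes B: "right_ideal B R" "semisimple_ideal B" "B \<subseteq> I" and N: "essential_in N I"
  shows "B \<subseteq> N"
proof -
  have Nr: "right_ideal N R" using N by (simp add: essential_in_def)
  let ?X = "B \<inter> N"
  have X: "right_ideal ?X R" by (rule right_ideal_Int[OF B(1) Nr])
  obtain p where p: "right_linear B ?X p" "\<And>x. x \<in> ?X \<Longrightarrow> p x = x"
    by (rule semisimple_retract[OF B(2) X]) (blast, rule that)
  let ?Z = "{x \<in> B. p x = \<zero>}"
  have Z: "right_ideal ?Z R" by (rule right_ideal_kernel[OF p(1) B(1) X])
  have "?Z \<inter> N = {\<zero>}" using p(2) right_idealD(2)[OF Z] right_idealD(2)[OF Nr] by auto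
  then have Z0: "?Z = {\<zero>}" using N Z B(3) unfolding essential_in_def by blast
  have "inj_on p B"
    by (rule right_linear_inj_on[OF p(1) B(1) X]) (use Z0 in blast)
  then show ?thesis using p right_linearD(1)[OF p(1)]
    by (metis (no_types, lifting) IntD1 IntD2 inj_onD subsetI)
qed

end

context maximal_square
begin

lemma carr: "a \<in> A \<Longrightarrow> a \<in> carrier R" "a \<in> A' \<Longrightarrow> a \<in> carrier R" "e \<in> carrier R" "e' \<in> carrier R"
  using right_idealD(1)[OF A] right_idealD(1)[OF A'] e_in e'_in by auto

lemma disjoint: "A \<inter> A' = {\<zero>}"
proof -
  have "x = \<zero>" if "x \<in> A" "x \<in> A'" for x using eA[OF that(1)] eA'[OF that(2)] by simp
  then show ?thesis using right_idealD(2)[OF A] right_idealD(2)[OF A'] by blast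
qed

lemma semisimple_A: "semisimple_ideal A"
proof (rule square_semisimple[OF A right_linear_mono[OF lin subset_refl] inj])
  show "A' \<subseteq> carrier R" using carr by auto
  show "A \<inter> \<sigma> ` A = {\<zero>}"
    using disjoint img by simp
qed

lemma semisimple_A': "semisimple_ideal A'"
proof (rule square_semisimple[OF A'])
  have "right_linear A' A (inv_into A \<sigma>)" using right_linear_inv_into[OF lin A inj] img by simp
  then show "right_linear A' (carrier R) (inv_into A \<sigma>)"
    by (rule right_linear_mono) (use carr in auto)
  show "inj_on (inv_into A \<sigma>) A'" using img by (auto intro: inj_on_inv_into)
  have "inv_into A \<sigma> ` A' = A" using img inj by (simp add: inv_into_image_cancel flip: img)
  then show "A' \<inter> inv_into A \<sigma> ` A' = {\<zero>}" using disjoint by auto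
qed

text \<open>
  The pair \<open>L\<close>, \<open>f\<close> is a maximal isomorphism from a right ideal annihilated by \<open>e\<close> and \<open>e'\<close> onto a
  right ideal inside \<open>A\<close>, and \<open>h = e + e' + l\<close> where \<open>L = lR\<close>.  The three idempotents are orthogonal:
  \<open>l\<close> kills \<open>A\<close> and \<open>A'\<close> by the choice made in \<open>square_summand\<close>, and \<open>e\<close>, \<open>e'\<close> kill \<open>L\<close> by
  construction.
\<close>

lemma central_idempotent_exists:
  obtains h where "h \<in> carrier R" "h \<otimes> h = h" "\<And>r. r \<in> carrier R \<Longrightarrow> h \<otimes> r = r \<otimes> h"
    "e \<otimes> h = e" "e' \<otimes> h = e'"
    "\<And>X. right_ideal X R \<Longrightarrow> X \<subseteq> {x \<in> carrier R. h \<otimes> x = x} \<Longrightarrow>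
      \<exists>Y. right_ideal Y R \<and> Y \<subseteq> {x \<in> carrier R. h \<otimes> x = x} \<and> X \<inter> Y = {\<zero>} \<and>
        X <+>\<^bsub>R\<^esub> Y = {x \<in> carrier R. h \<otimes> x = x}"
    "\<And>N. right_ideal N R \<Longrightarrow> N \<subseteq> {x \<in> carrier R. h \<otimes> x = x} \<Longrightarrow> N \<noteq> {\<zero>} \<Longrightarrow>
      \<exists>\<phi>. right_linear {x \<in> carrier R. h \<otimes> x = x} A \<phi> \<and> (\<exists>x\<in>N. \<phi> x \<noteq> \<zero>)"
    "A \<subseteq> {x \<in> carrier R. h \<otimes> x = x}" "A' \<subseteq> {x \<in> carrier R. h \<otimes> x = x}"
proof (rule maximal_injective_linear[of "\<lambda>x y z w. e \<otimes> x = \<zero> \<and> e' \<otimes> x = \<zero> \<and> y \<in> A"])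
  show "e \<otimes> \<zero> = \<zero> \<and> e' \<otimes> \<zero> = \<zero> \<and> \<zero> \<in> A" using carr right_idealD(2)[OF A] by simp
  fix L f
  assume L: "right_ideal L R" and f: "right_linear L (carrier R) f" and fi: "inj_on f L"
    and Q: "\<And>x y. x \<in> L \<Longrightarrow> y \<in> L \<Longrightarrow> e \<otimes> x = \<zero> \<and> e' \<otimes> x = \<zero> \<and> f x \<in> A"
    and max: "\<And>W \<alpha> \<beta> w. \<lbrakk>right_ideal W R; right_linear W (carrier R) \<alpha>; right_linear W (carrier R) \<beta>;
       \<And>x w. x \<in> L \<Longrightarrow> w \<in> W \<Longrightarrow> x \<oplus> \<alpha> w = \<zero> \<longleftrightarrow> f x \<oplus> \<beta> w = \<zero>;
       \<And>x w y v. x \<in> L \<Longrightarrow> w \<in> W \<Longrightarrow> y \<in> L \<Longrightarrow> v \<in> W \<Longrightarrow>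
         e \<otimes> (x \<oplus> \<alpha> w) = \<zero> \<and> e' \<otimes> (x \<oplus> \<alpha> w) = \<zero> \<and> f x \<oplus> \<beta> w \<in> A;
       w \<in> W\<rbrakk> \<Longrightarrow> \<alpha> w \<in> L"
  note a = right_idealD[OF A] and a' = right_idealD[OF A'] and l = right_idealD[OF L]
    and F = right_linearD[OF f]
  have LK: "e \<otimes> x = \<zero>" "e' \<otimes> x = \<zero>" "f x \<in> A" if "x \<in> L" for x using Q[OF that that] by auto
  have f0: "f \<zero> = \<zero>" by (rule right_linear_zero[OF f L right_ideal_carrier])
  have fz: "x = \<zero>" if "x \<in> L" "f x = \<zero>" for x using fi that l(2) f0 by (metis inj_onD)
  have lA: "right_linear L A f" using f LK by (auto simp: right_linear_def)
  have fL: "right_ideal (f ` L) R" "f ` L \<subseteq> A"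
    using right_ideal_image[OF f L right_ideal_carrier] LK by auto
  let ?B = "A <+>\<^bsub>R\<^esub> A'"
  have B: "right_ideal ?B R" by (rule right_ideal_sum[OF A A'])
  have "x = \<zero>" if x: "x \<in> L" "x \<in> ?B" for x
  proof -
    obtain p q where pq: "p \<in> A" "q \<in> A'" "x = p \<oplus> q" using x(2) by (rule in_sumE)
    have "e \<otimes> x = p" "e' \<otimes> x = q" using pq eA eA' e'A e'A' carr by (simp_all add: r_distr)
    then have "p = \<zero>" "q = \<zero>" using LK x by auto
    then show ?thesis using pq(3) by simp
  qed
  then have LB: "L \<inter> ?B = {\<zero>}" using l(2) right_idealD(2)[OF B] by blast
  obtain l where lL: "l \<in> L" "\<And>x. x \<in> L \<Longrightarrow> l \<otimes> x = x" and lB: "\<And>x. x \<in> ?B \<Longrightarrow> l \<otimes> x = \<zero>"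
    by (rule square_summand[OF L B LB right_linear_mono[OF lA subset_refl sum_upper(1)[OF A A']] fi])
       (rule that)
  have lc: "l \<in> carrier R" using lL l by auto
  have lAA': "l \<otimes> x = \<zero>" if "x \<in> A \<or> x \<in> A'" for x
    using lB sum_upper[OF A A'] that by blast
  define h where "h = e \<oplus> e' \<oplus> l"
  have hc: "h \<in> carrier R" using carr lc by (simp add: h_def)
  have hx: "h \<otimes> x = e \<otimes> x \<oplus> e' \<otimes> x \<oplus> l \<otimes> x" if "x \<in> carrier R" for x
    using that carr lc by (simp add: h_def l_distr)
  have eh: "e \<otimes> h = e" "e' \<otimes> h = e'" "l \<otimes> h = l"
    using carr lc eA eA' e'A e'A' LK lL lAA' e_in e'_in by (simp_all add: h_def r_distr)
  have hh: "h \<otimes> h = h" using hx[OF hc] eh by (simp add: h_def)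
  have hA: "h \<otimes> x = x" if "x \<in> A" for x using hx[OF carr(1)[OF that]] that eA e'A lAA' carr by simp
  have hA': "h \<otimes> x = x" if "x \<in> A'" for x using hx[OF carr(2)[OF that]] that eA' e'A' lAA' carr by simp
  have hL: "h \<otimes> x = x" if "x \<in> L" for x using hx[OF l(1)[OF that]] that LK lL l by simp

  let ?k = "\<one> \<ominus> h"
  have kc: "?k \<in> carrier R" using hc by simp
  \<comment> \<open>Left multiplication by \<open>t\<close> maps \<open>A\<close> to \<open>(1 - h)R\<close>.  On the summand \<open>A1\<close> of \<open>A\<close> complementary to its
    kernel it is injective.  The part \<open>W\<close> of \<open>A1\<close> that the retraction \<open>p\<close> onto \<open>f ` L\<close> kills would
    enlarge \<open>L\<close>, so \<open>p\<close> is injective on \<open>A1\<close>.  Then \<open>A1\<close> has a second copy inside \<open>L\<close>, and the two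
    copies form a square annihilated by \<open>e\<close> and \<open>e'\<close>.\<close>
  have no_map_to_rest: "t = \<zero>" if t: "t \<in> carrier R" "e \<otimes> t = \<zero>" "e' \<otimes> t = \<zero>" "l \<otimes> t = \<zero>" "t \<otimes> e = t" for t
  proof -
    obtain p where p: "right_linear A (f ` L) p" "\<And>x. x \<in> f ` L \<Longrightarrow> p x = x"
      by (rule semisimple_retract[OF semisimple_A fL]) (rule that)
    note P = right_linearD[OF p(1)]
    have tlin: "right_linear A (carrier R) ((\<otimes>) t)"
      by (rule right_linear_mult) (use t carr in auto)
    let ?Z = "{x \<in> A. t \<otimes> x = \<zero>}"
    have Z: "right_ideal ?Z R" by (rule right_ideal_kernel[OF tlin A right_ideal_carrier])
    obtain q where q: "right_linear A ?Z q" "\<And>x. x \<in> ?Z \<Longrightarrow> q x = x"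
      by (rule semisimple_retract[OF semisimple_A Z]) (blast, rule that)
    note q' = right_linearD[OF q(1)]
    let ?A1 = "{x \<in> A. q x = \<zero>}"
    have A1: "right_ideal ?A1 R" by (rule right_ideal_kernel[OF q(1) A Z])
    have tA1: "x = \<zero>" if "x \<in> ?A1" "t \<otimes> x = \<zero>" for x using q(2)[of x] that by auto
    let ?W = "?A1 \<inter> {x \<in> A. p x = \<zero>}"
    have W: "right_ideal ?W R"
      by (rule right_ideal_Int[OF A1 right_ideal_kernel[OF p(1) A fL(1)]])
    have tx: "e \<otimes> (t \<otimes> x) = \<zero>" "e' \<otimes> (t \<otimes> x) = \<zero>" "l \<otimes> (t \<otimes> x) = \<zero>" if "x \<in> carrier R" for x
      using t that carr lc by (simp_all flip: m_assoc)
    have W0: "w = \<zero>" if w: "w \<in> ?W" for w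
    proof -
      have "t \<otimes> w \<in> L"
      proof (rule max[OF W _ _ _ _ w, of "(\<otimes>) t" "\<lambda>x. x"])
        show "right_linear ?W (carrier R) ((\<otimes>) t)" by (rule right_linear_mono[OF tlin]) auto
        show "right_linear ?W (carrier R) (\<lambda>x. x)" by (rule right_linear_mono[OF right_linear_id]) (use carr in auto)
        fix x w assume x: "x \<in> L" and w: "w \<in> ?W"
        have k: "x \<in> carrier R" "w \<in> carrier R" "f x \<in> carrier R" using x w l a F by auto
        show "x \<oplus> t \<otimes> w = \<zero> \<longleftrightarrow> f x \<oplus> w = \<zero>"
        proof
          assume g: "x \<oplus> t \<otimes> w = \<zero>"
          have "l \<otimes> (x \<oplus> t \<otimes> w) = x" using k t lc tx x lL by (simp add: r_distr)
          then have x0: "x = \<zero>" using g lc by simp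
          then have "t \<otimes> w = \<zero>" using g k t by simp
          then have "w = \<zero>" using tA1 w by blast
          then show "f x \<oplus> w = \<zero>" using x0 f0 by simp
        next
          assume g: "f x \<oplus> w = \<zero>"
          have "p (f x \<oplus> w) = f x" using P(2)[of "f x" w] LK x w p(2) k by simp
          then have x0: "f x = \<zero>" using g right_linear_zero[OF p(1) A fL(1)] by simp
          then have "w = \<zero>" using g k by simp
          then show "x \<oplus> t \<otimes> w = \<zero>" using fz[OF x x0] t by simp
        qed
        show "e \<otimes> (x \<oplus> t \<otimes> w) = \<zero> \<and> e' \<otimes> (x \<oplus> t \<otimes> w) = \<zero> \<and> f x \<oplus> w \<in> A"
          using x w k t tx LK carr a(3) by (simp add: r_distr)
      qed
      then have "t \<otimes> w = \<zero>" using lL(2) tx(3) w a(1) by fastforce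
      then show ?thesis using tA1 w by blast
    qed
    have gl: "right_linear (f ` L) (carrier R) (inv_into L f)"
      using right_linear_mono[OF right_linear_inv_into[OF f L fi] subset_refl] l(1) by blast
    have fp: "inv_into L f (p x) \<in> L" "f (inv_into L f (p x)) = p x" if "x \<in> A" for x
      using P(1)[OF that] by (auto simp: inv_into_into f_inv_into_f)
    have "?A1 = {\<zero>}"
    proof (rule square_free[OF A1, of "(\<otimes>) t" "\<lambda>x. inv_into L f (p x)"])
      show 1: "right_linear ?A1 (carrier R) ((\<otimes>) t)" by (rule right_linear_mono[OF tlin]) auto
      show "inj_on ((\<otimes>) t) ?A1" by (rule right_linear_inj_on[OF 1 A1 right_ideal_carrier]) (rule tA1)
      show 2: "right_linear ?A1 (carrier R) (\<lambda>x. inv_into L f (p x))"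
        by (rule right_linear_mono[OF right_linear_comp[OF p(1) gl]]) auto
      show "inj_on (\<lambda>x. inv_into L f (p x)) ?A1"
      proof (rule right_linear_inj_on[OF 2 A1 right_ideal_carrier])
        fix x assume x: "x \<in> ?A1" "inv_into L f (p x) = \<zero>"
        then have "p x = \<zero>" using fp(2)[of x] f0 by simp
        then show "x = \<zero>" using W0 x by blast
      qed
      have "y = \<zero>" if y: "y \<in> (\<otimes>) t ` ?A1" "y \<in> (\<lambda>x. inv_into L f (p x)) ` ?A1" for y
      proof -
        have "l \<otimes> y = \<zero>" using y(1) tx a(1) by auto
        moreover have "l \<otimes> y = y" using y(2) fp lL by auto
        ultimately show ?thesis by simp
      qed
      then show "(\<otimes>) t ` ?A1 \<inter> (\<lambda>x. inv_into L f (p x)) ` ?A1 = {\<zero>}"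
        using right_idealD(2)[OF right_ideal_image[OF 1 A1 right_ideal_carrier]]
          right_idealD(2)[OF right_ideal_image[OF 2 A1 right_ideal_carrier]] by blast
      show "e \<otimes> (t \<otimes> w) = \<zero> \<and> e' \<otimes> (t \<otimes> w) = \<zero> \<and> e \<otimes> inv_into L f (p w) = \<zero> \<and> e' \<otimes> inv_into L f (p w) = \<zero>"
        if "w \<in> ?A1" for w using that tx fp LK a by auto
    qed
    then have "inj_on q A" by (intro right_linear_inj_on[OF q(1) A Z]) blast
    moreover have "q e \<in> ?Z" using q'(1) e_in by blast
    ultimately have "e \<in> ?Z" using q(2) e_in by (metis (no_types, lifting) inj_onD mem_Collect_eq)
    then show ?thesis using t by simp
  qed
  have ek: "e \<otimes> ?k = \<zero>" "e' \<otimes> ?k = \<zero>" "l \<otimes> ?k = \<zero>" "h \<otimes> ?k = \<zero>" "?k \<otimes> ?k = ?k"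
  proof -
    show 1: "e \<otimes> ?k = \<zero>" "e' \<otimes> ?k = \<zero>" "l \<otimes> ?k = \<zero>" "h \<otimes> ?k = \<zero>"
      using hc carr lc eh hh by (simp_all add: a_minus_def r_distr r_minus r_neg)
    have "?k \<otimes> ?k = \<one> \<otimes> ?k \<ominus> h \<otimes> ?k" using hc kc by (simp add: a_minus_def l_distr l_minus)
    then show "?k \<otimes> ?k = ?k" using 1(4) kc by (simp add: a_minus_def)
  qed
  have k_R_e: "?k \<otimes> r \<otimes> e = \<zero>" if r: "r \<in> carrier R" for r
  proof (rule no_map_to_rest)
    show "e \<otimes> (?k \<otimes> r \<otimes> e) = \<zero>" "e' \<otimes> (?k \<otimes> r \<otimes> e) = \<zero>" "l \<otimes> (?k \<otimes> r \<otimes> e) = \<zero>"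
      using ek kc r carr lc by (simp_all flip: m_assoc)
    show "?k \<otimes> r \<otimes> e \<otimes> e = ?k \<otimes> r \<otimes> e" using kc r carr eA[OF e_in] by (simp add: m_assoc)
  qed (use kc r carr in simp)

  \<comment> \<open>The image \<open>uR\<close> of a map from \<open>(1 - h)R\<close> to \<open>A\<close> is a summand \<open>bR\<close> with \<open>b = u s\<close> idempotent.
    The map back from \<open>A\<close> to \<open>(1 - h)R\<close> is left multiplication by \<open>(1 - h) s b\<close>, which is zero, so
    \<open>b = u (1 - h) s b = 0\<close>.\<close>
  have e_R_k: "e \<otimes> r \<otimes> ?k = \<zero>" if r: "r \<in> carrier R" for r
  proof -
    define u where "u = e \<otimes> r \<otimes> ?k"
    have uA: "u \<in> A" using a e_in r kc by (simp add: u_def)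
    have uc: "u \<in> carrier R" using uA carr by simp
    have uk: "u \<otimes> ?k = u" using r kc carr ek by (simp add: u_def m_assoc)
    let ?U = "(\<otimes>) u ` carrier R"
    have U: "right_ideal ?U R" "?U \<subseteq> A" using right_ideal_principal[OF uc] a(4)[OF uA] by auto
    obtain p where p: "right_linear A ?U p" "\<And>x. x \<in> ?U \<Longrightarrow> p x = x"
      by (rule semisimple_retract[OF semisimple_A U]) (rule that)
    define b where "b = p e"
    have bU: "b \<in> ?U" using right_linearD(1)[OF p(1) e_in] by (simp add: b_def)
    then obtain s where s: "s \<in> carrier R" "b = u \<otimes> s" by auto
    have bc: "b \<in> carrier R" using s uc by simp
    have bx: "b \<otimes> x = x" if "x \<in> ?U" for x
      using right_linearD(3)[OF p(1) e_in, of x] p(2)[OF that] that U(2) eA carr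
      by (metis b_def subsetD)
    have be: "b \<otimes> e = b" using right_linearD(3)[OF p(1) e_in carr(3)] eA[OF e_in] by (simp add: b_def)
    have "?k \<otimes> (s \<otimes> b) \<otimes> e = \<zero>" using k_R_e[of "s \<otimes> b"] s bc by simp
    then have c: "?k \<otimes> (s \<otimes> b) = \<zero>" using kc s bc carr be by (simp add: m_assoc)
    have "b = b \<otimes> b" using bx[OF bU] by simp
    also have "\<dots> = u \<otimes> ?k \<otimes> s \<otimes> b" using uk s by simp
    also have "\<dots> = u \<otimes> (?k \<otimes> (s \<otimes> b))" using uc kc s(1) bc by (simp add: m_assoc)
    finally have "b = \<zero>" using c uc by simp
    moreover have "u \<in> ?U" using uc by (auto intro!: image_eqI[of _ _ \<one>])
    ultimately show ?thesis using bx[of u] uc by (simp add: u_def)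
  qed

  \<comment> \<open>The elements \<open>x\<close> with \<open>(1 - h)Rx = 0 = xR(1 - h)\<close> form a two-sided ideal.  It contains \<open>e\<close>, hence
    also \<open>e'\<close> and \<open>l\<close>, which factor through \<open>e\<close> by means of \<open>\<sigma>\<close> and \<open>f\<close>.\<close>
  let ?D = "{x \<in> carrier R. \<forall>r\<in>carrier R. ?k \<otimes> r \<otimes> x = \<zero> \<and> x \<otimes> r \<otimes> ?k = \<zero>}"
  have Dadd: "x \<oplus> y \<in> ?D" if "x \<in> ?D" "y \<in> ?D" for x y
    using that kc by (auto simp: l_distr r_distr)
  have Dmult: "x \<otimes> e \<otimes> y \<in> ?D" if xy: "x \<in> carrier R" "y \<in> carrier R" for x y
  proof -
    have "?k \<otimes> r \<otimes> (x \<otimes> e \<otimes> y) = \<zero> \<and> (x \<otimes> e \<otimes> y) \<otimes> r \<otimes> ?k = \<zero>" if r: "r \<in> carrier R" for r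
    proof
      have "?k \<otimes> r \<otimes> (x \<otimes> e \<otimes> y) = (?k \<otimes> (r \<otimes> x) \<otimes> e) \<otimes> y"
        using xy r kc carr by (simp add: m_assoc)
      then show "?k \<otimes> r \<otimes> (x \<otimes> e \<otimes> y) = \<zero>" using k_R_e[of "r \<otimes> x"] xy r by simp
      have "(x \<otimes> e \<otimes> y) \<otimes> r \<otimes> ?k = x \<otimes> (e \<otimes> (y \<otimes> r) \<otimes> ?k)"
        using xy r kc carr by (simp add: m_assoc)
      then show "(x \<otimes> e \<otimes> y) \<otimes> r \<otimes> ?k = \<zero>" using e_R_k[of "y \<otimes> r"] xy r by simp
    qed
    then show ?thesis using xy carr by simp
  qed
  have "e = \<one> \<otimes> e \<otimes> \<one>" using carr by simp
  then have eD: "e \<in> ?D" using Dmult[of \<one> \<one>] by simp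
  have e'D: "e' \<in> ?D"
  proof -
    obtain y where y: "y \<in> A" "\<sigma> y = e'" using e'_in img by auto
    have "\<sigma> e \<otimes> e \<otimes> y = e'"
      using right_linearD(3)[OF lin e_in carr(3)] right_linearD(3)[OF lin e_in carr(1)[OF y(1)]] eA[OF e_in] eA[OF y(1)] y(2)
      by simp
    then show ?thesis using Dmult[of "\<sigma> e" y] right_linearD(1)[OF lin e_in] carr y by simp
  qed
  have lD: "l \<in> ?D"
  proof -
    obtain p where p: "right_linear A (f ` L) p" "\<And>x. x \<in> f ` L \<Longrightarrow> p x = x"
      by (rule semisimple_retract[OF semisimple_A fL]) (rule that)
    note g = right_linear_comp[OF p(1) right_linear_inv_into[OF f L fi]]
    let ?g = "\<lambda>x. inv_into L f (p x)"
    have gf: "?g (f l) = l" using p(2)[of "f l"] fi lL by simp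
    have "?g e \<otimes> e \<otimes> f l = l"
      using right_linearD(3)[OF g e_in carr(3)] right_linearD(3)[OF g e_in carr(1)[OF LK(3)[OF lL(1)]]]
        eA[OF e_in] eA[OF LK(3)[OF lL(1)]] gf by simp
    then show ?thesis using Dmult[of "?g e" "f l"] right_linearD(1)[OF g e_in] l(1) F(1)[OF lL(1)] by simp
  qed
  have hD: "h \<in> ?D" using Dadd[OF Dadd[OF eD e'D] lD] by (simp only: h_def[symmetric])
  have central: "h \<otimes> r = r \<otimes> h" if r: "r \<in> carrier R" for r
  proof -
    have "?k \<otimes> r \<otimes> h = \<zero>" "h \<otimes> r \<otimes> ?k = \<zero>" using hD r by auto
    then have "r \<otimes> h \<ominus> h \<otimes> r \<otimes> h = \<zero>" "h \<otimes> r \<ominus> h \<otimes> r \<otimes> h = \<zero>"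
      using r hc by (simp_all add: a_minus_def l_distr r_distr l_minus r_minus)
    then show ?thesis using eq_if_minus_zero r hc by (metis m_closed)
  qed

  let ?S = "{x \<in> carrier R. h \<otimes> x = x}"
  have S: "right_ideal ?S R"
  proof (rule right_idealI)
    show "x \<oplus> y \<in> ?S" if "x \<in> ?S" "y \<in> ?S" for x y using that hc by (simp add: r_distr)
    show "x \<otimes> r \<in> ?S" if "x \<in> ?S" "r \<in> carrier R" for x r using that hc by (simp flip: m_assoc)
  qed (use hc in auto)
  have sub: "A \<subseteq> ?S" "A' \<subseteq> ?S" "L \<subseteq> ?S" using hA hA' hL carr l by auto
  have semiL: "semisimple_ideal L"
  proof (rule square_semisimple[OF L f fi])
    have "x = \<zero>" if "x \<in> L" "x \<in> A" for x using LK(1)[OF that(1)] eA[OF that(2)] by simp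
    then show "L \<inter> f ` L = {\<zero>}" using fL l(2) right_idealD(2)[OF fL(1)] by blast
  qed
  \<comment> \<open>A complement \<open>Y\<close> of \<open>X\<close> makes \<open>X + Y\<close> essential in \<open>hR\<close>, so it contains each of the semisimple right
    ideals \<open>A\<close>, \<open>A'\<close>, \<open>L\<close> that span \<open>hR\<close>.\<close>
  have compl: "\<exists>Y. right_ideal Y R \<and> Y \<subseteq> ?S \<and> X \<inter> Y = {\<zero>} \<and> X <+>\<^bsub>R\<^esub> Y = ?S"
    if X: "right_ideal X R" "X \<subseteq> ?S" for X
  proof -
    have "{\<zero>} \<subseteq> ?S" "X \<inter> {\<zero>} = {\<zero>}" using right_idealD(2)[OF S] right_idealD(2)[OF X(1)] by auto
    then obtain Y where Y: "right_ideal Y R" "Y \<subseteq> ?S" "X \<inter> Y = {\<zero>}" "essential_in (X <+>\<^bsub>R\<^esub> Y) ?S"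
      by (rule complement_exists[OF X(1) right_ideal_zero S X(2)]) (rule that)
    have XY: "right_ideal (X <+>\<^bsub>R\<^esub> Y) R" by (rule right_ideal_sum[OF X(1) Y(1)])
    have s: "A \<subseteq> X <+>\<^bsub>R\<^esub> Y" "A' \<subseteq> X <+>\<^bsub>R\<^esub> Y" "L \<subseteq> X <+>\<^bsub>R\<^esub> Y"
      using semisimple_subset_essential[OF A semisimple_A sub(1) Y(4)]
        semisimple_subset_essential[OF A' semisimple_A' sub(2) Y(4)]
        semisimple_subset_essential[OF L semiL sub(3) Y(4)] by auto
    have "?S \<subseteq> X <+>\<^bsub>R\<^esub> Y"
    proof
      fix x assume x: "x \<in> ?S"
      then have "x = e \<otimes> x \<oplus> e' \<otimes> x \<oplus> l \<otimes> x" using hx by auto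
      moreover have "e \<otimes> x \<in> X <+>\<^bsub>R\<^esub> Y" "e' \<otimes> x \<in> X <+>\<^bsub>R\<^esub> Y" "l \<otimes> x \<in> X <+>\<^bsub>R\<^esub> Y"
        using x s a(4)[OF e_in] a'(4)[OF e'_in] l(4)[OF lL(1)] by auto
      ultimately show "x \<in> X <+>\<^bsub>R\<^esub> Y" using right_idealD(3)[OF XY] by metis
    qed
    then have "X <+>\<^bsub>R\<^esub> Y = ?S" using sum_least[OF S X(2) Y(2)] by blast
    then show ?thesis using Y by blast
  qed
  \<comment> \<open>The components in \<open>A\<close>, \<open>A'\<close> and \<open>L\<close> all embed in \<open>A\<close>, and a nonzero element has a nonzero
    component.\<close>
  have homs: "\<exists>\<phi>. right_linear ?S A \<phi> \<and> (\<exists>x\<in>N. \<phi> x \<noteq> \<zero>)"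
    if N: "right_ideal N R" "N \<subseteq> ?S" "N \<noteq> {\<zero>}" for N
  proof -
    obtain x where x: "x \<in> N" "x \<noteq> \<zero>" using N right_idealD(2)[OF N(1)] by blast
    have xc: "x \<in> carrier R" "h \<otimes> x = x" using x N by auto
    have e': "right_linear ?S A' ((\<otimes>) e')"
      by (rule right_linear_mult) (use carr a'(4)[OF e'_in] in auto)
    have i: "right_linear A' A (inv_into A \<sigma>)" using right_linear_inv_into[OF lin A inj] img by simp
    have l': "right_linear ?S L ((\<otimes>) l)"
      by (rule right_linear_mult) (use lc l(4)[OF lL(1)] in auto)
    have "e \<otimes> x \<noteq> \<zero> \<or> e' \<otimes> x \<noteq> \<zero> \<or> l \<otimes> x \<noteq> \<zero>" using x hx[OF xc(1)] xc by auto
    moreover have "right_linear ?S A ((\<otimes>) e)"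
      by (rule right_linear_mult) (use carr a(4)[OF e_in] in auto)
    moreover have "right_linear ?S A (\<lambda>x. inv_into A \<sigma> (e' \<otimes> x))" by (rule right_linear_comp[OF e' i])
    moreover have "e' \<otimes> x = \<zero>" if "inv_into A \<sigma> (e' \<otimes> x) = \<zero>"
    proof -
      have "e' \<otimes> x \<in> \<sigma> ` A" using a'(4)[OF e'_in xc(1)] img by simp
      then have "e' \<otimes> x = \<sigma> \<zero>" using that f_inv_into_f by metis
      then show ?thesis using right_linear_zero[OF lin A A'] by simp
    qed
    moreover have "right_linear ?S A (\<lambda>x. f (l \<otimes> x))" by (rule right_linear_comp[OF l' lA])
    moreover have "l \<otimes> x = \<zero>" if "f (l \<otimes> x) = \<zero>" using fz that l(4)[OF lL(1) xc(1)] by blast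
    ultimately show ?thesis using x(1) by blast
  qed
  show thesis
    by (rule that[OF hc hh _ eh(1,2)]) (fact central compl homs sub)+
qed

end

text \<open>
  A right ideal \<open>N\<close> of \<open>hR\<close> with a nonzero map \<open>\<phi>\<close> to \<open>A\<close> contains, next to the kernel, a nonzero
  right ideal \<open>K\<close> on which \<open>\<phi>\<close> is injective; then \<open>\<phi>\<close> and \<open>\<sigma> \<circ> \<phi>\<close> are embeddings of \<open>K\<close> in \<open>A\<close>
  and \<open>A'\<close>.
\<close>

lemma (in aut_extension_ring) square_decomposition:
  obtains h where "h \<in> carrier R" "h \<otimes> h = h" "\<And>r. r \<in> carrier R \<Longrightarrow> h \<otimes> r = r \<otimes> h"
    "\<And>X. right_ideal X R \<Longrightarrow> X \<subseteq> {x \<in> carrier R. h \<otimes> x = x} \<Longrightarrow>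
      \<exists>Y. right_ideal Y R \<and> Y \<subseteq> {x \<in> carrier R. h \<otimes> x = x} \<and> X \<inter> Y = {\<zero>} \<and>
        X <+>\<^bsub>R\<^esub> Y = {x \<in> carrier R. h \<otimes> x = x}"
    "\<And>N. right_ideal N R \<Longrightarrow> N \<subseteq> {x \<in> carrier R. h \<otimes> x = x} \<Longrightarrow> N \<noteq> {\<zero>} \<Longrightarrow>
      \<exists>K \<alpha> \<beta>. right_ideal K R \<and> K \<subseteq> N \<and> K \<noteq> {\<zero>} \<and>
        right_linear K {x \<in> carrier R. h \<otimes> x = x} \<alpha> \<and> inj_on \<alpha> K \<and>
        right_linear K {x \<in> carrier R. h \<otimes> x = x} \<beta> \<and> inj_on \<beta> K \<and> \<alpha> ` K \<inter> \<beta> ` K = {\<zero>}"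
    "\<And>K \<alpha> \<beta>. \<lbrakk>right_ideal K R; right_linear K {x \<in> carrier R. h \<otimes> x = \<zero>} \<alpha>; inj_on \<alpha> K;
      right_linear K {x \<in> carrier R. h \<otimes> x = \<zero>} \<beta>; inj_on \<beta> K; \<alpha> ` K \<inter> \<beta> ` K = {\<zero>}\<rbrakk>
      \<Longrightarrow> K = {\<zero>}"
proof -
  obtain A A' \<sigma> e e' where "maximal_square R A A' \<sigma> e e'" by (rule maximal_square_exists)
  then interpret maximal_square R A A' \<sigma> e e' .
  show thesis
  proof (rule central_idempotent_exists)
    fix h
    let ?S = "{x \<in> carrier R. h \<otimes> x = x}" and ?T = "{x \<in> carrier R. h \<otimes> x = \<zero>}"
    assume h: "h \<in> carrier R" "h \<otimes> h = h" and central: "\<And>r. r \<in> carrier R \<Longrightarrow> h \<otimes> r = r \<otimes> h"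
      and eh: "e \<otimes> h = e" "e' \<otimes> h = e'"
      and compl: "\<And>X. right_ideal X R \<Longrightarrow> X \<subseteq> ?S \<Longrightarrow>
        \<exists>Y. right_ideal Y R \<and> Y \<subseteq> ?S \<and> X \<inter> Y = {\<zero>} \<and> X <+>\<^bsub>R\<^esub> Y = ?S"
      and homs: "\<And>N. right_ideal N R \<Longrightarrow> N \<subseteq> ?S \<Longrightarrow> N \<noteq> {\<zero>} \<Longrightarrow>
        \<exists>\<phi>. right_linear ?S A \<phi> \<and> (\<exists>x\<in>N. \<phi> x \<noteq> \<zero>)"
      and sub: "A \<subseteq> ?S" "A' \<subseteq> ?S"
    have full: "\<exists>K \<alpha> \<beta>. right_ideal K R \<and> K \<subseteq> N \<and> K \<noteq> {\<zero>} \<and> right_linear K ?S \<alpha> \<and> inj_on \<alpha> K \<and>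
        right_linear K ?S \<beta> \<and> inj_on \<beta> K \<and> \<alpha> ` K \<inter> \<beta> ` K = {\<zero>}"
      if N: "right_ideal N R" "N \<subseteq> ?S" "N \<noteq> {\<zero>}" for N
    proof -
      obtain \<phi> x where \<phi>: "right_linear ?S A \<phi>" and x: "x \<in> N" "\<phi> x \<noteq> \<zero>" using homs[OF N] by blast
      have \<phi>N: "right_linear N A \<phi>" using right_linear_mono[OF \<phi> N(2)] by blast
      let ?Z = "{x \<in> N. \<phi> x = \<zero>}"
      have Z: "right_ideal ?Z R" by (rule right_ideal_kernel[OF \<phi>N N(1) A])
      have "?Z \<subseteq> ?S" using N(2) by blast
      from compl[OF Z this]
      obtain Y where Y: "right_ideal Y R" "?Z \<inter> Y = {\<zero>}" "?Z <+>\<^bsub>R\<^esub> Y = ?S" by blast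
      let ?K = "N \<inter> Y"
      have K: "right_ideal ?K R" by (rule right_ideal_Int[OF N(1) Y(1)])
      have "x \<in> ?Z <+>\<^bsub>R\<^esub> Y" using x N(2) Y(3) by blast
      then obtain z y where zy: "z \<in> ?Z" "y \<in> Y" "x = z \<oplus> y" by (rule in_sumE)
      have c: "z \<in> carrier R" "y \<in> carrier R" using right_idealD(1)[OF Z zy(1)] right_idealD(1)[OF Y(1) zy(2)] .
      have "y = \<ominus> z \<oplus> x" using c zy by (simp add: r_neg1)
      moreover have "\<ominus> z \<oplus> x \<in> N" using right_idealD(3,5)[OF N(1)] zy(1) x(1) by simp
      ultimately have "y \<in> ?K" using zy(2) by simp
      moreover have "y \<noteq> \<zero>" using zy x c by auto
      ultimately have K0: "?K \<noteq> {\<zero>}" by blast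
      have \<phi>K: "right_linear ?K A \<phi>" using right_linear_mono[OF \<phi>N] by blast
      have \<phi>i: "inj_on \<phi> ?K"
        by (rule right_linear_inj_on[OF \<phi>K K A]) (use Y(2) in blast)
      have \<beta>: "right_linear ?K A' (\<lambda>x. \<sigma> (\<phi> x))" by (rule right_linear_comp[OF \<phi>K lin])
      have \<beta>i: "inj_on (\<lambda>x. \<sigma> (\<phi> x)) ?K"
        using inj_onD[OF inj] inj_onD[OF \<phi>i] right_linearD(1)[OF \<phi>K] by (intro inj_onI) blast
      have "\<phi> ` ?K \<inter> (\<lambda>x. \<sigma> (\<phi> x)) ` ?K \<subseteq> A \<inter> A'"
        by (intro Int_mono image_subsetI) (fact right_linearD(1)[OF \<phi>K] right_linearD(1)[OF \<beta>])+
      moreover have "\<zero> \<in> \<phi> ` ?K" "\<zero> \<in> (\<lambda>x. \<sigma> (\<phi> x)) ` ?K"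
        using right_idealD(2)[OF right_ideal_image[OF \<phi>K K A]] right_idealD(2)[OF right_ideal_image[OF \<beta> K A']] .
      ultimately have d: "\<phi> ` ?K \<inter> (\<lambda>x. \<sigma> (\<phi> x)) ` ?K = {\<zero>}"
        using disjoint by (metis (no_types, lifting) Int_iff empty_subsetI insert_subset subset_antisym)
      show ?thesis
      proof (rule exI[of _ ?K], rule exI[of _ \<phi>], rule exI[of _ "\<lambda>x. \<sigma> (\<phi> x)"], intro conjI)
        show "right_linear ?K ?S \<phi>" by (rule right_linear_mono[OF \<phi>K subset_refl sub(1)])
        show "right_linear ?K ?S (\<lambda>x. \<sigma> (\<phi> x))" by (rule right_linear_mono[OF \<beta> subset_refl sub(2)])
      qed (rule K K0 \<phi>i \<beta>i d Int_lower1)+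
    qed
    have free: "K = {\<zero>}" if K: "right_ideal K R" and \<alpha>: "right_linear K ?T \<alpha>" "inj_on \<alpha> K"
      and \<beta>: "right_linear K ?T \<beta>" "inj_on \<beta> K" and d: "\<alpha> ` K \<inter> \<beta> ` K = {\<zero>}" for K \<alpha> \<beta>
    proof (rule square_free[OF K _ \<alpha>(2) _ \<beta>(2) d])
      show "right_linear K (carrier R) \<alpha>" "right_linear K (carrier R) \<beta>"
        using right_linear_mono[OF \<alpha>(1) subset_refl] right_linear_mono[OF \<beta>(1) subset_refl] by auto
      have "e \<otimes> x = \<zero> \<and> e' \<otimes> x = \<zero>" if "x \<in> ?T" for x
      proof -
        have "c \<otimes> x = \<zero>" if c: "c \<in> carrier R" "c \<otimes> h = c" for c
        proof -
          have "c \<otimes> x = c \<otimes> h \<otimes> x" using c(2) by simp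
          also have "\<dots> = c \<otimes> (h \<otimes> x)" using m_assoc[OF c(1) h(1)] \<open>x \<in> ?T\<close> by blast
          finally show ?thesis using c(1) \<open>x \<in> ?T\<close> by simp
        qed
        then show ?thesis using carr eh by blast
      qed
      then show "e \<otimes> \<alpha> w = \<zero> \<and> e' \<otimes> \<alpha> w = \<zero> \<and> e \<otimes> \<beta> w = \<zero> \<and> e' \<otimes> \<beta> w = \<zero>" if "w \<in> K" for w
        using that right_linearD(1)[OF \<alpha>(1)] right_linearD(1)[OF \<beta>(1)] by blast
    qed
    show thesis by (rule that[OF h]) (fact central compl full free)+
  qed
qed

section \<open>Semisimple rings are artinian\<close>

context ring
begin

text \<open>
  Complements \<open>M n\<close> of the members of a descending chain \<open>N n\<close> can be chosen ascending.  The union of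
  the \<open>M n\<close> is a summand of the ring, so it is generated by one element, which lies in some \<open>M k\<close>.
  From \<open>k\<close> on the complements do not change, and neither do the \<open>N n\<close>, by the modular law.
\<close>

lemma semisimple_imp_artinian:
  assumes "semisimple_rmodule R (right_regular R)"
  shows "artinian_rmodule R (right_regular R)"
  unfolding artinian_rmodule_def
proof (intro allI impI)
  fix N :: "nat \<Rightarrow> 'a set"
  assume "\<forall>n. right_ideal (N n) R \<and> N (Suc n) \<subseteq> N n"
  then have N: "\<And>n. right_ideal (N n) R" and dec: "\<And>n. N (Suc n) \<subseteq> N n" by auto
  have mono: "N m \<subseteq> N n" if "n \<le> m" for n m using lift_Suc_antimono_le[of N, OF dec that] .
  have compl: "\<exists>Y. right_ideal Y R \<and> X \<inter> Y = {\<zero>} \<and> X <+>\<^bsub>R\<^esub> Y = carrier R" if "right_ideal X R" for X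
    using assms that unfolding semisimple_rmodule_def by (auto simp: right_regular_def set_add_def')
  let ?P = "\<lambda>n C. right_ideal C R \<and> N n \<inter> C = {\<zero>} \<and> N n <+>\<^bsub>R\<^esub> C = carrier R"
  have "\<exists>M. \<forall>n. ?P n (M n) \<and> M n \<subseteq> M (Suc n)"
  proof (rule dependent_nat_choice)
    show "\<exists>C. ?P 0 C" using compl[OF N] by blast
    fix C n assume "?P n C"
    then have C: "right_ideal C R" and d: "N n \<inter> C = {\<zero>}" by auto
    let ?X = "N (Suc n) <+>\<^bsub>R\<^esub> C"
    have X: "right_ideal ?X R" by (rule right_ideal_sum[OF N C])
    obtain Y where Y: "right_ideal Y R" and XY: "?X \<inter> Y = {\<zero>}" "?X <+>\<^bsub>R\<^esub> Y = carrier R"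
      using compl[OF X] by blast
    let ?D = "C <+>\<^bsub>R\<^esub> Y"
    have D: "right_ideal ?D R" by (rule right_ideal_sum[OF C Y])
    have "x = \<zero>" if x: "x \<in> N (Suc n)" "x \<in> ?D" for x
    proof -
      obtain c y where cy: "c \<in> C" "y \<in> Y" "x = c \<oplus> y" using x(2) by (rule in_sumE)
      have k: "c \<in> carrier R" "y \<in> carrier R" "x \<in> carrier R"
        using cy x right_idealD(1)[OF C] right_idealD(1)[OF Y] right_idealD(1)[OF N] by auto
      have "y = x \<oplus> \<ominus> c" using cy k r_neg1[of c y] a_comm[of x "\<ominus> c"] by simp
      then have "y \<in> ?X" using in_sumI[OF x(1) right_idealD(5)[OF C cy(1)]] by simp
      then have "y = \<zero>" using XY cy by blast
      then have "x = c" using cy k by simp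
      then show ?thesis using d x(1) dec[of n] cy(1) by blast
    qed
    then have "N (Suc n) \<inter> ?D = {\<zero>}" using right_idealD(2)[OF N] right_idealD(2)[OF D] by blast
    moreover have "N (Suc n) <+>\<^bsub>R\<^esub> ?D = carrier R"
    proof
      have ND: "right_ideal (N (Suc n) <+>\<^bsub>R\<^esub> ?D) R" by (rule right_ideal_sum[OF N D])
      have s: "N (Suc n) \<subseteq> N (Suc n) <+>\<^bsub>R\<^esub> ?D" "?D \<subseteq> N (Suc n) <+>\<^bsub>R\<^esub> ?D" "C \<subseteq> ?D" "Y \<subseteq> ?D"
        using sum_upper[OF N D] sum_upper[OF C Y] by blast+
      have "?X \<subseteq> N (Suc n) <+>\<^bsub>R\<^esub> ?D" by (rule sum_least[OF ND]) (use s in blast)+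
      then have "?X <+>\<^bsub>R\<^esub> Y \<subseteq> N (Suc n) <+>\<^bsub>R\<^esub> ?D" by (rule sum_least[OF ND]) (use s in blast)
      then show "carrier R \<subseteq> N (Suc n) <+>\<^bsub>R\<^esub> ?D" using XY by simp
      show "N (Suc n) <+>\<^bsub>R\<^esub> ?D \<subseteq> carrier R" using right_idealD(1)[OF ND] by blast
    qed
    ultimately show "\<exists>D. ?P (Suc n) D \<and> C \<subseteq> D" using D sum_upper(1)[OF C Y] by blast
  qed
  then obtain M where M: "\<And>n. right_ideal (M n) R" "\<And>n. N n \<inter> M n = {\<zero>}"
    "\<And>n. N n <+>\<^bsub>R\<^esub> M n = carrier R" "\<And>n. M n \<subseteq> M (Suc n)" by blast
  have Mmono: "M n \<subseteq> M m" if "n \<le> m" for n m using lift_Suc_mono_le[of M, OF M(4) that] .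
  let ?U = "\<Union>n. M n"
  have U: "right_ideal ?U R"
  proof (rule right_idealI)
    fix x assume "x \<in> ?U"
    then obtain i where i: "x \<in> M i" by blast
    show "x \<in> carrier R" using right_idealD(1)[OF M(1) i] .
    show "x \<otimes> r \<in> ?U" if "r \<in> carrier R" for r using right_idealD(4)[OF M(1) i that] by blast
    show "x \<oplus> y \<in> ?U" if y: "y \<in> ?U" for y
    proof -
      obtain j where j: "y \<in> M j" using y by blast
      have "x \<in> M (max i j)" "y \<in> M (max i j)"
        using i j Mmono[of i "max i j"] Mmono[of j "max i j"] by auto
      then show ?thesis using right_idealD(3)[OF M(1)] by blast
    qed
  qed (use right_idealD(2)[OF M(1)] in blast)
  obtain W where W: "right_ideal W R" "?U \<inter> W = {\<zero>}" "?U <+>\<^bsub>R\<^esub> W = carrier R" using compl[OF U] by blast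
  have "\<one> \<in> ?U <+>\<^bsub>R\<^esub> W" using W(3) by simp
  then obtain u w where uw: "u \<in> ?U" "w \<in> W" "\<one> = u \<oplus> w" by (rule in_sumE)
  obtain k where k: "u \<in> M k" using uw(1) by blast
  have kc: "u \<in> carrier R" "w \<in> carrier R" using right_idealD(1)[OF M(1) k] right_idealD(1)[OF W(1) uw(2)] .
  have UM: "x \<in> M k" if x: "x \<in> ?U" for x
  proof -
    have xc: "x \<in> carrier R" using right_idealD(1)[OF U x] .
    have ux: "u \<otimes> x \<in> M k" using right_idealD(4)[OF M(1) k xc] .
    have "(u \<oplus> w) \<otimes> x = x" using xc by (simp flip: uw(3))
    then have "x = u \<otimes> x \<oplus> w \<otimes> x" using kc xc l_distr[of u w x] by simp
    moreover have "x = x \<oplus> \<zero>" using xc by simp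
    ultimately have "x = u \<otimes> x"
      using direct_sum_cancel[OF U W(1,2) x right_idealD(2)[OF W(1)], of "u \<otimes> x" "w \<otimes> x"]
        ux right_idealD(4)[OF W(1) uw(2) xc] by auto
    then show ?thesis using ux by simp
  qed
  have "N m = N k" if m: "k \<le> m" for m
  proof
    show "N m \<subseteq> N k" by (rule mono[OF m])
    show "N k \<subseteq> N m"
    proof
      fix x assume x: "x \<in> N k"
      then have "x \<in> N m <+>\<^bsub>R\<^esub> M m" using M(3) right_idealD(1)[OF N] by blast
      then obtain n c where nc: "n \<in> N m" "c \<in> M m" "x = n \<oplus> c" by (rule in_sumE)
      have cM: "c \<in> M k" using UM nc by blast
      have nk: "n \<in> N k" using nc mono[OF m] by blast
      have c: "n \<in> carrier R" "c \<in> carrier R" "x \<in> carrier R"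
        using right_idealD(1)[OF N nk] right_idealD(1)[OF M(1) cM] right_idealD(1)[OF N x] .
      have "x = x \<oplus> \<zero>" using c by simp
      then have "x = n"
        using direct_sum_cancel[OF N M(1) M(2) x right_idealD(2)[OF M(1)] nk cM] nc by auto
      then show "x \<in> N m" using nc by simp
    qed
  qed
  then show "\<exists>n. \<forall>m\<ge>n. N m = N n" by blast
qed

end

section \<open>Splitting a ring along a central idempotent\<close>

definition corner_ring :: "('a, 'm) ring_scheme \<Rightarrow> 'a \<Rightarrow> 'a ring" where
  "corner_ring R g =
     \<lparr>carrier = {x \<in> carrier R. g \<otimes>\<^bsub>R\<^esub> x = x}, mult = mult R, one = g, zero = zero R, add = add R\<rparr>"

locale central_idempotent = ring +
  fixes g
  assumes g_closed: "g \<in> carrier R" and g_idem: "g \<otimes> g = g"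
    and g_central: "\<And>r. r \<in> carrier R \<Longrightarrow> g \<otimes> r = r \<otimes> g"
begin

abbreviation "corner \<equiv> {x \<in> carrier R. g \<otimes> x = x}"

lemma corner_simps:
  "carrier (corner_ring R g) = corner" "x \<otimes>\<^bsub>corner_ring R g\<^esub> y = x \<otimes> y" "\<one>\<^bsub>corner_ring R g\<^esub> = g"
  "\<zero>\<^bsub>corner_ring R g\<^esub> = \<zero>" "x \<oplus>\<^bsub>corner_ring R g\<^esub> y = x \<oplus> y"
  by (simp_all add: corner_ring_def)

lemma mult_corner: "x \<in> corner \<Longrightarrow> r \<in> carrier R \<Longrightarrow> x \<otimes> r \<in> corner"
  using g_closed by (simp flip: m_assoc)

lemma right_ideal_corner: "right_ideal corner R"
  by (rule right_idealI) (use mult_corner g_closed in \<open>auto simp: r_distr\<close>)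

lemma ring_corner: "ring (corner_ring R g)"
proof (rule ringI)
  show "abelian_group (corner_ring R g)"
  proof (rule abelian_groupI)
    fix x assume "x \<in> carrier (corner_ring R g)"
    then have x: "x \<in> corner" by (simp add: corner_simps)
    then have "\<ominus> x \<in> corner" by (rule right_idealD(5)[OF right_ideal_corner])
    moreover have "\<ominus> x \<oplus> x = \<zero>" using x by (simp add: l_neg)
    ultimately show "\<exists>y\<in>carrier (corner_ring R g). y \<oplus>\<^bsub>corner_ring R g\<^esub> x = \<zero>\<^bsub>corner_ring R g\<^esub>"
      by (auto simp only: corner_simps)
  next
    show "\<zero>\<^bsub>corner_ring R g\<^esub> \<in> carrier (corner_ring R g)"
      unfolding corner_simps by (rule right_idealD(2)[OF right_ideal_corner])
    fix x y assume "x \<in> carrier (corner_ring R g)" "y \<in> carrier (corner_ring R g)"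
    then have xy: "x \<in> corner" "y \<in> corner" by (simp_all only: corner_simps)
    show "x \<oplus>\<^bsub>corner_ring R g\<^esub> y \<in> carrier (corner_ring R g)"
      unfolding corner_simps by (rule right_idealD(3)[OF right_ideal_corner xy])
    show "x \<oplus>\<^bsub>corner_ring R g\<^esub> y = y \<oplus>\<^bsub>corner_ring R g\<^esub> x"
      unfolding corner_simps using xy by (auto intro: a_comm)
  qed (unfold corner_simps, auto intro: a_assoc)
  have neutral: "g \<otimes> x = x" "x \<otimes> g = x" if "x \<in> corner" for x using that g_central[of x] by auto
  show "Group.monoid (corner_ring R g)"
  proof (rule monoidI; unfold corner_simps)
    show "x \<otimes> y \<in> corner" if "x \<in> corner" "y \<in> corner" for x y using mult_corner[OF that(1)] that(2) by blast
    show "g \<in> corner" using g_closed g_idem by blast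
    show "x \<otimes> y \<otimes> z = x \<otimes> (y \<otimes> z)" if "x \<in> corner" "y \<in> corner" "z \<in> corner" for x y z
      using that m_assoc[of x y z] by blast
  qed (fact neutral)+
next
  fix x y z
  assume "x \<in> carrier (corner_ring R g)" "y \<in> carrier (corner_ring R g)" "z \<in> carrier (corner_ring R g)"
  then have "x \<in> carrier R" "y \<in> carrier R" "z \<in> carrier R" by (simp_all add: corner_simps)
  then show "(x \<oplus>\<^bsub>corner_ring R g\<^esub> y) \<otimes>\<^bsub>corner_ring R g\<^esub> z =
      x \<otimes>\<^bsub>corner_ring R g\<^esub> z \<oplus>\<^bsub>corner_ring R g\<^esub> y \<otimes>\<^bsub>corner_ring R g\<^esub> z"
    "z \<otimes>\<^bsub>corner_ring R g\<^esub> (x \<oplus>\<^bsub>corner_ring R g\<^esub> y) =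
      z \<otimes>\<^bsub>corner_ring R g\<^esub> x \<oplus>\<^bsub>corner_ring R g\<^esub> z \<otimes>\<^bsub>corner_ring R g\<^esub> y"
    unfolding corner_simps by (simp_all add: l_distr r_distr)
qed

lemma mult_via_g: "x \<in> corner \<Longrightarrow> r \<in> carrier R \<Longrightarrow> x \<otimes> r = x \<otimes> (g \<otimes> r)"
  using g_closed g_central[of x] by (simp flip: m_assoc)

lemma g_mult_corner: "r \<in> carrier R \<Longrightarrow> g \<otimes> r \<in> corner"
  using g_closed g_idem by (simp flip: m_assoc)

text \<open>
  Elements \<open>r\<close> and \<open>g r\<close> act in the same way on \<open>gR\<close> from the right, so modules over the corner and
  right ideals of the ring inside \<open>gR\<close> are the same.
\<close>

lemma right_ideal_corner_iff:
  "right_ideal I (corner_ring R g) \<longleftrightarrow> right_ideal I R \<and> I \<subseteq> corner"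
proof
  assume "right_ideal I (corner_ring R g)"
  then have I: "I \<subseteq> corner" "\<zero> \<in> I" "\<And>x y. x \<in> I \<Longrightarrow> y \<in> I \<Longrightarrow> x \<oplus> y \<in> I"
    "\<And>x r. x \<in> I \<Longrightarrow> r \<in> corner \<Longrightarrow> x \<otimes> r \<in> I"
    unfolding ring.right_ideal_iff[OF ring_corner] corner_simps by blast+
  have "right_ideal I R"
  proof (rule right_idealI)
    fix x r assume x: "x \<in> I" and r: "r \<in> carrier R"
    then show "x \<otimes> r \<in> I" using mult_via_g[OF _ r] g_mult_corner[OF r] I(1) I(4)[OF x] by auto
  qed (use I in auto)
  then show "right_ideal I R \<and> I \<subseteq> corner" using I by simp
next
  assume I: "right_ideal I R \<and> I \<subseteq> corner"
  then show "right_ideal I (corner_ring R g)"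
    unfolding ring.right_ideal_iff[OF ring_corner] corner_simps
    using right_idealD[of I] by auto
qed

text \<open>
  An embedding of \<open>N \<oplus> N\<close> amounts to two embeddings \<open>\<alpha>\<close>, \<open>\<beta>\<close> of \<open>N\<close> whose images meet in zero, namely
  its restrictions to the summands.  Squares in a corner are thereby expressed inside the ring.
\<close>

lemma square_root_corner_iff:
  "square_root_in N (corner_ring R g) (right_regular (corner_ring R g)) \<longleftrightarrow>
    right_ideal N R \<and> N \<subseteq> corner \<and>
    (\<exists>\<alpha> \<beta>. right_linear N corner \<alpha> \<and> inj_on \<alpha> N \<and> right_linear N corner \<beta> \<and> inj_on \<beta> N \<and> \<alpha> ` N \<inter> \<beta> ` N = {\<zero>})"
  (is "?sq \<longleftrightarrow> ?r")
proof -
  let ?C = "corner_ring R g"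
  let ?NN = "rmodule_sum (restrict_rmodule (right_regular ?C) N) (restrict_rmodule (right_regular ?C) N)"
  have NN: "f \<in> rmodule_hom ?C ?NN (right_regular ?C) \<longleftrightarrow>
      (\<forall>x\<in>N. \<forall>y\<in>N. f (x, y) \<in> corner) \<and>
      (\<forall>x\<in>N. \<forall>y\<in>N. \<forall>x'\<in>N. \<forall>y'\<in>N. f (x \<oplus> x', y \<oplus> y') = f (x, y) \<oplus> f (x', y')) \<and>
      (\<forall>x\<in>N. \<forall>y\<in>N. \<forall>r\<in>corner. f (x \<otimes> r, y \<otimes> r) = f (x, y) \<otimes> r)" for f
    unfolding rmodule_hom_def rmodule_sum_def right_regular_def corner_ring_def
    by (simp add: Pi_iff)
  have carNN: "carrier ?NN = N \<times> N" by (simp add: rmodule_sum_def)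
  show ?thesis
  proof
    assume sq: ?sq
    then have N: "right_ideal N R" "N \<subseteq> corner"
      using right_ideal_corner_iff by (auto simp: square_root_in_def)
    note n = right_idealD[OF N(1)]
    obtain f where f: "f \<in> rmodule_hom ?C ?NN (right_regular ?C)" and i: "inj_on f (N \<times> N)"
      using sq carNN by (auto simp: square_root_in_def rmodule_embeds_def)
    have F: "\<And>x y. x \<in> N \<Longrightarrow> y \<in> N \<Longrightarrow> f (x, y) \<in> corner"
      "\<And>x y x' y'. x \<in> N \<Longrightarrow> y \<in> N \<Longrightarrow> x' \<in> N \<Longrightarrow> y' \<in> N \<Longrightarrow> f (x \<oplus> x', y \<oplus> y') = f (x, y) \<oplus> f (x', y')"
      "\<And>x y r. x \<in> N \<Longrightarrow> y \<in> N \<Longrightarrow> r \<in> corner \<Longrightarrow> f (x \<otimes> r, y \<otimes> r) = f (x, y) \<otimes> r"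
      using f unfolding NN by blast+
    have Fr: "f (x \<otimes> r, y \<otimes> r) = f (x, y) \<otimes> r" if "x \<in> N" "y \<in> N" "r \<in> carrier R" for x y r
    proof -
      have "x \<otimes> r = x \<otimes> (g \<otimes> r)" "y \<otimes> r = y \<otimes> (g \<otimes> r)" "f (x, y) \<otimes> r = f (x, y) \<otimes> (g \<otimes> r)"
        using mult_via_g that N(2) F(1)[OF that(1,2)] by blast+
      then show ?thesis using F(3)[OF that(1,2) g_mult_corner[OF that(3)]] by simp
    qed
    have a: "right_linear N corner (\<lambda>x. f (x, \<zero>))"
    proof (rule right_linearI)
      show "f (x, \<zero>) \<in> corner" if "x \<in> N" for x using F(1)[OF that n(2)] .
      show "f (x \<oplus> y, \<zero>) = f (x, \<zero>) \<oplus> f (y, \<zero>)" if "x \<in> N" "y \<in> N" for x y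
        using F(2)[OF that(1) n(2) that(2) n(2)] by simp
      show "f (x \<otimes> r, \<zero>) = f (x, \<zero>) \<otimes> r" if "x \<in> N" "r \<in> carrier R" for x r
        using Fr[OF that(1) n(2) that(2)] that by simp
    qed
    have b: "right_linear N corner (\<lambda>x. f (\<zero>, x))"
    proof (rule right_linearI)
      show "f (\<zero>, x) \<in> corner" if "x \<in> N" for x using F(1)[OF n(2) that] .
      show "f (\<zero>, x \<oplus> y) = f (\<zero>, x) \<oplus> f (\<zero>, y)" if "x \<in> N" "y \<in> N" for x y
        using F(2)[OF n(2) that(1) n(2) that(2)] by simp
      show "f (\<zero>, x \<otimes> r) = f (\<zero>, x) \<otimes> r" if "x \<in> N" "r \<in> carrier R" for x r
        using Fr[OF n(2) that] that by simp
    qed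
    have ai: "inj_on (\<lambda>x. f (x, \<zero>)) N" "inj_on (\<lambda>x. f (\<zero>, x)) N"
      using inj_onD[OF i] n(2) by (auto intro!: inj_onI)
    have f0: "f (\<zero>, \<zero>) = \<zero>" using right_linear_zero[OF a N(1) right_ideal_corner] .
    have "y = \<zero>" if y: "y \<in> (\<lambda>x. f (x, \<zero>)) ` N" "y \<in> (\<lambda>x. f (\<zero>, x)) ` N" for y
    proof -
      obtain p q where pq: "p \<in> N" "q \<in> N" "y = f (p, \<zero>)" "y = f (\<zero>, q)" using y by auto
      then have "(p, \<zero>) = (\<zero>, q)" using inj_onD[OF i, of "(p, \<zero>)" "(\<zero>, q)"] n(2) by auto
      then show ?thesis using pq f0 by simp
    qed
    moreover have "\<zero> \<in> (\<lambda>x. f (x, \<zero>)) ` N" "\<zero> \<in> (\<lambda>x. f (\<zero>, x)) ` N"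
      using f0 n(2) by (auto intro!: image_eqI[of _ _ \<zero>])
    ultimately have "(\<lambda>x. f (x, \<zero>)) ` N \<inter> (\<lambda>x. f (\<zero>, x)) ` N = {\<zero>}" by blast
    then show ?r using N a b ai by blast
  next
    assume ?r
    then obtain \<alpha> \<beta> where N: "right_ideal N R" "N \<subseteq> corner"
      and a: "right_linear N corner \<alpha>" "inj_on \<alpha> N" and b: "right_linear N corner \<beta>" "inj_on \<beta> N"
      and d: "\<alpha> ` N \<inter> \<beta> ` N = {\<zero>}" by blast
    note n = right_idealD[OF N(1)] and L = right_linearD[OF a(1)] and B = right_linearD[OF b(1)]
    have k: "\<alpha> x \<in> carrier R" "\<beta> x \<in> carrier R" if "x \<in> N" for x using L(1) B(1) that by auto
    let ?f = "\<lambda>(x, y). \<alpha> x \<oplus> \<beta> y"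
    have "?f \<in> rmodule_hom ?C ?NN (right_regular ?C)"
      unfolding NN prod.case
    proof (intro conjI ballI)
      show "\<alpha> x \<oplus> \<beta> y \<in> corner" if "x \<in> N" "y \<in> N" for x y
        using right_idealD(3)[OF right_ideal_corner L(1)[OF that(1)] B(1)[OF that(2)]] .
      show "\<alpha> (x \<oplus> x') \<oplus> \<beta> (y \<oplus> y') = (\<alpha> x \<oplus> \<beta> y) \<oplus> (\<alpha> x' \<oplus> \<beta> y')"
        if "x \<in> N" "y \<in> N" "x' \<in> N" "y' \<in> N" for x y x' y'
        using that k L(2) B(2) by (simp add: a_ac)
      show "\<alpha> (x \<otimes> r) \<oplus> \<beta> (y \<otimes> r) = (\<alpha> x \<oplus> \<beta> y) \<otimes> r" if "x \<in> N" "y \<in> N" "r \<in> corner" for x y r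
        using that k L(3) B(3) by (simp add: l_distr)
    qed
    moreover have "inj_on ?f (N \<times> N)"
    proof (rule inj_onI)
      fix p q assume pq: "p \<in> N \<times> N" "q \<in> N \<times> N" "?f p = ?f q"
      obtain x y x' y' where xy: "p = (x, y)" "q = (x', y')" by (cases p, cases q)
      have im: "right_ideal (\<alpha> ` N) R" "right_ideal (\<beta> ` N) R"
        using right_ideal_image[OF a(1) N(1) right_ideal_corner] right_ideal_image[OF b(1) N(1) right_ideal_corner] .
      have xN: "x \<in> N" "y \<in> N" "x' \<in> N" "y' \<in> N" using pq xy by auto
      have "\<alpha> x = \<alpha> x' \<and> \<beta> y = \<beta> y'"
      proof (rule direct_sum_cancel[OF im d])
        show "\<alpha> x \<oplus> \<beta> y = \<alpha> x' \<oplus> \<beta> y'" using pq(3) xy by simp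
      qed (rule imageI xN)+
      then show "p = q" using xy inj_onD[OF a(2) _ xN(1,3)] inj_onD[OF b(2) _ xN(2,4)] by simp
    qed
    ultimately show ?sq
      using N right_ideal_corner_iff carNN by (auto simp: square_root_in_def rmodule_embeds_def)
  qed
qed

lemma complement_central: "central_idempotent R (\<one> \<ominus> g)"
proof
  show "\<one> \<ominus> g \<in> carrier R" using g_closed by simp
  show "(\<one> \<ominus> g) \<otimes> (\<one> \<ominus> g) = \<one> \<ominus> g"
    using g_closed g_idem by (simp add: a_minus_def l_distr r_distr l_minus r_minus r_neg minus_add)
  show "(\<one> \<ominus> g) \<otimes> r = r \<otimes> (\<one> \<ominus> g)" if "r \<in> carrier R" for r
    using that g_closed g_central[OF that] by (simp add: a_minus_def l_distr r_distr l_minus r_minus)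
qed

lemma complement_carrier:
  "{x \<in> carrier R. (\<one> \<ominus> g) \<otimes> x = x} = {x \<in> carrier R. g \<otimes> x = \<zero>}"
proof -
  have "(\<one> \<ominus> g) \<otimes> x = x \<longleftrightarrow> g \<otimes> x = \<zero>" if x: "x \<in> carrier R" for x
  proof -
    have "(\<one> \<ominus> g) \<otimes> x = x \<ominus> g \<otimes> x" using x g_closed by (simp add: a_minus_def l_distr l_minus)
    moreover have "g \<otimes> x = \<zero>" if d: "x \<ominus> g \<otimes> x = x"
    proof -
      have gx: "g \<otimes> x \<in> carrier R" using x g_closed by simp
      have "\<ominus> (g \<otimes> x) = \<ominus> x \<oplus> (x \<ominus> g \<otimes> x)" using x gx by (simp add: a_minus_def r_neg1)
      also have "\<dots> = \<zero>" using d x by (simp add: l_neg)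
      finally have "\<ominus> (\<ominus> (g \<otimes> x)) = \<zero>" by simp
      then show ?thesis using gx by simp
    qed
    moreover have "g \<otimes> x = \<zero> \<Longrightarrow> x \<ominus> g \<otimes> x = x" using x by (simp add: a_minus_def)
    ultimately show ?thesis by metis
  qed
  then show ?thesis by blast
qed

lemma peirce_decomposition:
  "R \<simeq> RDirProd (corner_ring R g) (corner_ring R (\<one> \<ominus> g))"
proof -
  interpret k: central_idempotent R "\<one> \<ominus> g" by (rule complement_central)
  let ?k = "\<one> \<ominus> g"
  let ?P = "RDirProd (corner_ring R g) (corner_ring R ?k)"
  let ?f = "\<lambda>x. (g \<otimes> x, ?k \<otimes> x)"
  have kc: "?k \<in> carrier R" by (rule k.g_closed)
  have gk: "g \<oplus> ?k = \<one>" using g_closed r_neg2[of g \<one>] by (simp add: a_minus_def a_ac)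
  have dec: "g \<otimes> x \<oplus> ?k \<otimes> x = x" if "x \<in> carrier R" for x
    using that g_closed kc l_distr[of g ?k x] gk by simp
  have mult: "c \<otimes> (x \<otimes> y) = (c \<otimes> x) \<otimes> (c \<otimes> y)"
    if c: "central_idempotent R c" and xy: "x \<in> carrier R" "y \<in> carrier R" for c x y
  proof -
    interpret c: central_idempotent R c by (rule c)
    have "(c \<otimes> x) \<otimes> (c \<otimes> y) = c \<otimes> (c \<otimes> x) \<otimes> y"
      using c.g_central[of "c \<otimes> x"] c.g_closed xy by (simp add: m_assoc)
    also have "\<dots> = c \<otimes> (x \<otimes> y)" using c.g_closed c.g_idem xy by (simp flip: m_assoc)
    finally show ?thesis by simp
  qed
  have "?f \<in> ring_hom R ?P"
  proof (rule ring_hom_memI)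
    fix x assume x: "x \<in> carrier R"
    then show "?f x \<in> carrier ?P"
      using g_mult_corner k.g_mult_corner by (simp add: RDirProd_carrier corner_simps k.corner_simps)
    fix y assume y: "y \<in> carrier R"
    show "?f (x \<otimes> y) = ?f x \<otimes>\<^bsub>?P\<^esub> ?f y"
      using mult[OF central_idempotent_axioms x y] mult[OF complement_central x y]
      by (simp add: RDirProd_def DirProd_def monoid.defs corner_ring_def)
    show "?f (x \<oplus> y) = ?f x \<oplus>\<^bsub>?P\<^esub> ?f y"
      using x y g_closed kc by (simp add: RDirProd_def DirProd_def monoid.defs corner_ring_def r_distr)
  qed (use g_closed kc in \<open>simp add: RDirProd_def DirProd_def monoid.defs corner_ring_def\<close>)
  moreover have "bij_betw ?f (carrier R) (carrier ?P)"
  proof (rule bij_betwI[where g = "\<lambda>(x, y). x \<oplus> y"])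
    show "?f \<in> carrier R \<rightarrow> carrier ?P"
      using g_mult_corner k.g_mult_corner by (simp add: RDirProd_carrier corner_simps k.corner_simps)
    show "(\<lambda>(x, y). x \<oplus> y) \<in> carrier ?P \<rightarrow> carrier R"
      by (auto simp: RDirProd_carrier corner_simps k.corner_simps)
    show "(case ?f x of (x, y) \<Rightarrow> x \<oplus> y) = x" if "x \<in> carrier R" for x using dec[OF that] by simp
    fix p assume "p \<in> carrier ?P"
    then obtain x y where p: "p = (x, y)" and x: "x \<in> carrier R" "g \<otimes> x = x"
      and y: "y \<in> carrier R" "?k \<otimes> y = y"
      by (auto simp: RDirProd_carrier corner_simps k.corner_simps)
    have gy: "g \<otimes> y = \<zero>" using complement_carrier y by blast
    have "?k \<otimes> x = \<zero>" using x g_closed by (simp add: a_minus_def l_distr l_minus r_neg)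
    then show "?f (case p of (x, y) \<Rightarrow> x \<oplus> y) = p"
      using p x y gy g_closed kc by (simp add: r_distr)
  qed
  ultimately show ?thesis by (auto simp: is_ring_iso_def ring_iso_def)
qed

end

section \<open>The decomposition of a right a-ring\<close>

lemma aut_extension_ring_if_a_ring:
  assumes "right_a_ring R" shows "aut_extension_ring R"
proof -
  interpret ring R using assms by (simp add: right_a_ring_def)
  show ?thesis
    by unfold_locales (use a_ring_automorphism_extends[OF assms] in metis)
qed

theorem theorem3p4:
  fixes R :: "('a, 'm) ring_scheme"
  assumes "right_a_ring R"
  shows "\<exists>(S :: 'a ring) (T :: 'a ring).
           R \<simeq> RDirProd S T \<and>
           semisimple_artinian_ring S \<and> square_full_rmodule S (right_regular S) \<and>
           right_square_free_ring T"
proof -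
  interpret aut_extension_ring R by (rule aut_extension_ring_if_a_ring[OF assms])
  show ?thesis
  proof (rule square_decomposition)
    fix h
    let ?C = "{x \<in> carrier R. h \<otimes>\<^bsub>R\<^esub> x = x}"
    assume h: "h \<in> carrier R" "h \<otimes>\<^bsub>R\<^esub> h = h" "\<And>r. r \<in> carrier R \<Longrightarrow> h \<otimes>\<^bsub>R\<^esub> r = r \<otimes>\<^bsub>R\<^esub> h"
      and compl: "\<And>X. right_ideal X R \<Longrightarrow> X \<subseteq> ?C \<Longrightarrow>
        \<exists>Y. right_ideal Y R \<and> Y \<subseteq> ?C \<and> X \<inter> Y = {\<zero>\<^bsub>R\<^esub>} \<and> X <+>\<^bsub>R\<^esub> Y = ?C"
      and full: "\<And>N. right_ideal N R \<Longrightarrow> N \<subseteq> ?C \<Longrightarrow> N \<noteq> {\<zero>\<^bsub>R\<^esub>} \<Longrightarrow>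
        \<exists>K \<alpha> \<beta>. right_ideal K R \<and> K \<subseteq> N \<and> K \<noteq> {\<zero>\<^bsub>R\<^esub>} \<and> right_linear K ?C \<alpha> \<and> inj_on \<alpha> K \<and>
          right_linear K ?C \<beta> \<and> inj_on \<beta> K \<and> \<alpha> ` K \<inter> \<beta> ` K = {\<zero>\<^bsub>R\<^esub>}"
      and free: "\<And>K \<alpha> \<beta>. \<lbrakk>right_ideal K R; right_linear K {x \<in> carrier R. h \<otimes>\<^bsub>R\<^esub> x = \<zero>\<^bsub>R\<^esub>} \<alpha>; inj_on \<alpha> K;
        right_linear K {x \<in> carrier R. h \<otimes>\<^bsub>R\<^esub> x = \<zero>\<^bsub>R\<^esub>} \<beta>; inj_on \<beta> K; \<alpha> ` K \<inter> \<beta> ` K = {\<zero>\<^bsub>R\<^esub>}\<rbrakk>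
        \<Longrightarrow> K = {\<zero>\<^bsub>R\<^esub>}"
    interpret h: central_idempotent R h by unfold_locales (fact h)+
    interpret k: central_idempotent R "\<one>\<^bsub>R\<^esub> \<ominus>\<^bsub>R\<^esub> h" by (rule h.complement_central)
    let ?S = "corner_ring R h" and ?T = "corner_ring R (\<one>\<^bsub>R\<^esub> \<ominus>\<^bsub>R\<^esub> h)"
    have zero: "\<zero>\<^bsub>right_regular (corner_ring R c)\<^esub> = \<zero>\<^bsub>R\<^esub>" for c
      by (simp add: right_regular_def corner_ring_def)
    have sum: "X <+>\<^bsub>right_regular ?S\<^esub> Y = X <+>\<^bsub>R\<^esub> Y" for X Y
      by (simp add: set_add_def' right_regular_def corner_ring_def)
    have carS: "carrier (right_regular ?S) = ?C" by (simp add: right_regular_def corner_ring_def)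
    have ss: "semisimple_rmodule ?S (right_regular ?S)"
      unfolding semisimple_rmodule_def h.right_ideal_corner_iff zero sum carS
    proof (intro allI impI)
      fix X assume "right_ideal X R \<and> X \<subseteq> ?C"
      then have X: "right_ideal X R" "X \<subseteq> ?C" by simp_all
      show "\<exists>Y. (right_ideal Y R \<and> Y \<subseteq> ?C) \<and> X \<inter> Y = {\<zero>\<^bsub>R\<^esub>} \<and> X <+>\<^bsub>R\<^esub> Y = ?C"
        using compl[OF X] by (simp only: conj_assoc)
    qed
    have "semisimple_artinian_ring ?S"
      using h.ring_corner ss ring.semisimple_imp_artinian[OF h.ring_corner ss]
      by (simp add: semisimple_artinian_ring_def)
    moreover have "square_full_rmodule ?S (right_regular ?S)"
      unfolding square_full_rmodule_def h.right_ideal_corner_iff h.square_root_corner_iff zero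
    proof (intro allI impI)
      fix N assume "(right_ideal N R \<and> N \<subseteq> ?C) \<and> N \<noteq> {\<zero>\<^bsub>R\<^esub>}"
      then have N: "right_ideal N R" "N \<subseteq> ?C" "N \<noteq> {\<zero>\<^bsub>R\<^esub>}" by auto
      obtain K \<alpha> \<beta> where K: "right_ideal K R" "K \<subseteq> N" "K \<noteq> {\<zero>\<^bsub>R\<^esub>}"
        and sq: "right_linear K ?C \<alpha> \<and> inj_on \<alpha> K \<and> right_linear K ?C \<beta> \<and> inj_on \<beta> K \<and>
          \<alpha> ` K \<inter> \<beta> ` K = {\<zero>\<^bsub>R\<^esub>}"
        using full[OF N] by (elim exE conjE) (rule that; simp)
      have "K \<subseteq> ?C" using K(2) N(2) by (rule subset_trans)
      then show "\<exists>K\<subseteq>N. K \<noteq> {\<zero>\<^bsub>R\<^esub>} \<and> right_ideal K R \<and> K \<subseteq> ?C \<and>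
        (\<exists>\<alpha> \<beta>. right_linear K ?C \<alpha> \<and> inj_on \<alpha> K \<and> right_linear K ?C \<beta> \<and> inj_on \<beta> K \<and> \<alpha> ` K \<inter> \<beta> ` K = {\<zero>\<^bsub>R\<^esub>})"
        by (intro exI[of _ K] conjI) (rule K exI sq | assumption)+
    qed
    moreover have "right_square_free_ring ?T"
      unfolding right_square_free_ring_def square_free_rmodule_def k.square_root_corner_iff zero
        h.complement_carrier
    proof (intro conjI allI impI k.ring_corner, elim exE conjE)
    qed (rule free)
    ultimately show ?thesis using h.peirce_decomposition by blast
  qed
qed

end
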